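(* Assume the ballot hypothesis holds. Then for every integer $\ell\ge3$, \[T_\ell\le 10^{2^{\ell-3}}\prod_{i=0}^{\ell-4}\left((2^{\ell-i}-4)\,C_{2^{\ell-i-1}-1}\right)^{2^i}\] and \[Z_\ell\le(2^\ell-7)\left(\binom{2^\ell-6}{2^{\ell-1}-3}-\binom{2^\ell-6}{2^{\ell-1}-6}\right)10^{2^{\ell-3}}\prod_{i=0}^{\ell-5}\left((2^{\ell-1-i}-4)\,C_{2^{\ell-i-2}-1}\right)^{2^{i+1}},\] with empty products equal to $1$.
   Context: The tree is the infinite rooted binary tree (every vertex has a left and a right child) with a self-loop at the root; the root is on layer $1$ and children of a layer-$k$ vertex are on layer $k+1$. Labeled chip-firing: initially $N$ chips labeled $1,\dots,N$ sit at the root; a vertex with at least $3$ chips may fire by choosing any $3$ of its chips $a<b<c$ and sending $a$ to its left child, $c$ to its right child, and $b$ to its parent (the root keeps $b$). A stable configuration is one reached by finitely many fires in which no vertex holds $\ge 3$ chips; starting from $2^m-1$ chips, a stable configuration has exactly one chip on each vertex of layers $1,\dots,m$ and none elsewhere. $Z_\ell$ is the number of distinct stable configurations obtainable from $2^{\ell}-1$ labeled chips at the root. An order pattern of size $\ell$: take $m>\ell$, a stable configuration from $2^m-1$ labeled chips at the root, and a non-root vertex $v$ on layer $m-\ell+1$; on the $2^{\ell}-1$ vertices of the subtree of $v$ in layers $m-\ell+1,\dots,m$, replace each chip by its rank among these chips. $T_\ell$ is the number of distinct order patterns of size $\ell$. Ballot hypothesis (a conjecture of the paper): for every $m\ge1$,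 every stable configuration obtained from $2^m-1$ labeled chips at the root, and every vertex $v$ on layers $1,\dots,m-1$, for each $i$ the $i$-th smallest chip in the subtree rooted at the left child of $v$ is smaller than the $i$-th smallest chip in the subtree rooted at the right child of $v$. $C_n=\frac1{n+1}\binom{2n}{n}$ is the $n$-th Catalan number, and $\binom{a}{b}=0$ for $b<0$. *)

theory Defs
  imports Complex_Main
begin

text \<open>
  A vertex is the path leading to it from the root: \<open>False\<close> is a step to the left,
  \<open>True\<close> a step to the right. A configuration assigns to each vertex its set of chips.
\<close>

type_synonym vertex = "bool list"
type_synonym config = "vertex \<Rightarrow> nat set"

definition layer :: "vertex \<Rightarrow> nat" where
  "layer v = length v + 1"

definition left_child :: "vertex \<Rightarrow> vertex" where
  "left_child v = v @ [False]"

definition right_child :: "vertex \<Rightarrow> vertex" where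
  "right_child v = v @ [True]"

text \<open>The self-loop makes the root its own parent.\<close>

definition parent :: "vertex \<Rightarrow> vertex" where
  "parent v = (if v = [] then [] else butlast v)"

definition initial_config :: "nat \<Rightarrow> config" where
  "initial_config N = (\<lambda>v. if v = [] then {1..N} else {})"

definition fire :: "vertex \<Rightarrow> nat \<Rightarrow> nat \<Rightarrow> nat \<Rightarrow> config \<Rightarrow> config" where
  "fire v a b c K = (\<lambda>w.
     (if w = v then K w - {a, b, c} else K w)
     \<union> (if w = left_child v then {a} else {})
     \<union> (if w = parent v then {b} else {})
     \<union> (if w = right_child v then {c} else {}))"

inductive fires :: "config \<Rightarrow> config \<Rightarrow> bool" where
  "\<lbrakk>a \<in> K v; b \<in> K v; c \<in> K v; a < b; b < c\<rbrakk> \<Longrightarrow> fires K (fire v a b c K)"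

definition stable :: "config \<Rightarrow> bool" where
  "stable K \<longleftrightarrow> (\<forall>v. card (K v) < 3)"

definition stable_configs :: "nat \<Rightarrow> config set" where
  "stable_configs N = {K. fires\<^sup>*\<^sup>* (initial_config N) K \<and> stable K}"

text \<open>
  A stable configuration from \<open>2 ^ m - 1\<close> chips has exactly one chip on each vertex of layers
  \<open>1, \<dots>, m\<close> and none elsewhere. Hence the sets whose cardinalities define \<open>Z_num\<close> and
  \<open>T_num\<close> below are finite.
\<close>

definition Z_num :: "nat \<Rightarrow> nat" where
  "Z_num l = card (stable_configs (2 ^ l - 1))"

definition rank_in :: "nat set \<Rightarrow> nat \<Rightarrow> nat" where
  "rank_in S x = card {y \<in> S. y \<le> x}"

text \<open>
  The pattern on the top \<open>l\<close> layers of the subtree of \<open>v\<close>; its vertices are addressed by their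
  paths from \<open>v\<close>, so that patterns at different vertices can be compared.
\<close>

definition order_pattern :: "nat \<Rightarrow> config \<Rightarrow> vertex \<Rightarrow> vertex \<Rightarrow> nat set" where
  "order_pattern l K v =
     (let S = (\<Union>w \<in> {w. length w < l}. K (v @ w))
      in (\<lambda>w. if length w < l then rank_in S ` K (v @ w) else {}))"

definition order_patterns :: "nat \<Rightarrow> (vertex \<Rightarrow> nat set) set" where
  "order_patterns l =
     {order_pattern l K v | m K v.
        m > l \<and> K \<in> stable_configs (2 ^ m - 1) \<and> v \<noteq> [] \<and> layer v = m - l + 1}"

definition T_num :: "nat \<Rightarrow> nat" where
  "T_num l = card (order_patterns l)"

definition subtree_chips :: "config \<Rightarrow> vertex \<Rightarrow> nat set" where
  "subtree_chips K v = (\<Union>w. K (v @ w))"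

text \<open>
  The subtrees of the two children hold equally many chips, so the two bounds on \<open>i\<close> coincide;
  the index \<open>i\<close> is counted from 0.
\<close>

definition ballot_hypothesis :: bool where
  "ballot_hypothesis \<longleftrightarrow>
     (\<forall>m \<ge> 1. \<forall>K \<in> stable_configs (2 ^ m - 1). \<forall>v. 1 \<le> layer v \<and> layer v \<le> m - 1 \<longrightarrow>
        (let A = subtree_chips K (left_child v); B = subtree_chips K (right_child v)
         in \<forall>i. i < card A \<and> i < card B \<longrightarrow>
              sorted_list_of_set A ! i < sorted_list_of_set B ! i))"

definition catalan :: "nat \<Rightarrow> real" where
  "catalan n = 1 / (real n + 1) * real ((2 * n) choose n)"

definition binom :: "nat \<Rightarrow> int \<Rightarrow> real" where
  "binom a b = (if b < 0 then 0 else real (a choose nat b))"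

end

theory Submission
  imports Defs
begin

text \<open>
  A discrete maximum principle shows that every vertex fires a number of times depending only on its
  layer. Counted from the end, the last few fires of the vertices form waves running from the bottom
  to the root, in which each vertex fires exactly three chips. Tracing chips backwards through these
  waves shows, with the ballot hypothesis, that the final chip at a vertex is never among the two
  smallest chips of its subtree; a monovariant on the small chips shows that the two smallest chips
  below the root or a left child end in its left subtree. Reversing labels and reflecting the tree
  gives the statements about large chips. An order pattern is determined by the rank of its root
  chip, the ballot word recording how the chips of the two child subtrees interleave, and the two
  patterns there. The constraints leave \<open>10\<close> such pairs for size \<open>3\<close>, and the reflection principle
  counts the words in general.
\<close>

section \<open>Configurations and firing\<close>

text \<open>A run may fire in any order, so nothing local is known near its start. Near its end it
  is rigid: the total number of fires of each vertex is known, hence also how many remain, and a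
  fire needs three chips. A bound on the number of chips smaller than a final chip is raised one at
  a time, from \<open>j\<close> to \<open>j + 1\<close>. The obstacle is the left child: its final
  chip is the smallest of the three chips in the last fire of its parent, so no smaller chip is in
  sight and its origin has to be traced. Tracing may end in a sibling subtree; to use the small
  chips found there, \<open>j + 1\<close> small chips below a left child must imply
  \<open>j + 1\<close> small chips in its left subtree. For one chip this is the ballot condition,
  for two chips the monovariant gives it. This is the origin of the ranks \<open>3\<close> to
  \<open>2 ^ l - 3\<close>. At the root the chip of the left child lies below the root chip, which,
  together with its mirror image, gains one more at either end and leaves \<open>2 ^ l - 7\<close>
  ranks.\<close>

definition config_on :: "nat \<Rightarrow> config \<Rightarrow> bool" where
  "config_on N K \<longleftrightarrow> (\<forall>v w. v \<noteq> w \<longrightarrow> K v \<inter> K w = {}) \<and> (\<Union>v. K v) = {1..N}"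

lemma config_on_disjoint: "config_on N K \<Longrightarrow> x \<in> K v \<Longrightarrow> x \<in> K w \<Longrightarrow> v = w"
  unfolding config_on_def by blast

lemma config_on_range: "config_on N K \<Longrightarrow> x \<in> K v \<Longrightarrow> 1 \<le> x \<and> x \<le> N"
  unfolding config_on_def by (metis UN_I UNIV_I atLeastAtMost_iff)

lemma config_on_finite: "config_on N K \<Longrightarrow> finite (K v)"
  by (rule finite_subset[of _ "{1..N}"]) (auto dest: config_on_range)

lemma config_on_initial: "config_on N (initial_config N)"
  unfolding config_on_def initial_config_def by (auto split: if_splits)

lemma vertex_neq_child [simp]:
  "left_child v \<noteq> v" "right_child v \<noteq> v" "v \<noteq> left_child v" "v \<noteq> right_child v"
  "left_child v \<noteq> right_child w" "right_child v \<noteq> left_child w"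
  by (auto simp: left_child_def right_child_def)

lemma parent_neq_child [simp]:
  "parent v \<noteq> left_child v" "parent v \<noteq> right_child v"
  "left_child v \<noteq> parent v" "right_child v \<noteq> parent v"
proof -
  have "length (parent v) \<le> length v" by (simp add: parent_def)
  moreover have "length (left_child v) > length v" "length (right_child v) > length v"
    by (simp_all add: left_child_def right_child_def)
  ultimately show "parent v \<noteq> left_child v" "parent v \<noteq> right_child v"
    "left_child v \<noteq> parent v" "right_child v \<noteq> parent v" by (metis not_less)+
qed

lemma parent_snoc [simp]: "parent (v @ [d]) = v"
  by (simp add: parent_def)

lemma parent_Nil [simp]: "parent [] = []"
  by (simp add: parent_def)

lemma parent_children [simp]: "parent (left_child v) = v" "parent (right_child v) = v"
  by (simp_all add: left_child_def right_child_def)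

lemma parent_eq_self_iff: "parent v = v \<longleftrightarrow> v = []"
  by (metis append_butlast_last_id not_Cons_self2 append_self_conv parent_def)

lemma mem_fire_iff:
  "x \<in> fire v a b c K w \<longleftrightarrow>
     x \<in> K w \<and> (w = v \<longrightarrow> x \<noteq> a \<and> x \<noteq> b \<and> x \<noteq> c) \<or> w = left_child v \<and> x = a
     \<or> w = parent v \<and> x = b \<or> w = right_child v \<and> x = c"
  unfolding fire_def by auto

lemma config_on_fire:
  assumes K: "config_on N K" and abc: "a \<in> K v" "b \<in> K v" "c \<in> K v" "a < b" "b < c"
  shows "config_on N (fire v a b c K)"
proof -
  have d: "x \<in> K u \<Longrightarrow> x \<in> K w \<Longrightarrow> u = w" for x u w
    using K by (rule config_on_disjoint)
  have loc: "if x = a then u = left_child v else if x = b then u = parent v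
      else if x = c then u = right_child v else x \<in> K u" if "x \<in> fire v a b c K u" for x u
    using that abc d[of x v u] unfolding mem_fire_iff by auto
  have disj: "u = w" if "x \<in> fire v a b c K u" "x \<in> fire v a b c K w" for x u w
    using loc[OF that(1)] loc[OF that(2)] d[of x u w] by (auto split: if_splits)
  have "(\<exists>w. x \<in> fire v a b c K w) \<longleftrightarrow> (\<exists>w. x \<in> K w)" for x
    unfolding mem_fire_iff using abc by metis
  hence "(\<Union>w. fire v a b c K w) = (\<Union>w. K w)" by blast
  also have "\<dots> = {1..N}" using K by (simp add: config_on_def)
  finally show ?thesis unfolding config_on_def using disj by (simp add: disjoint_iff) blast
qed

text \<open>At the root \<open>parent v = v\<close>, so the sum of indicators also accounts for the
  self-loop, where a fire loses only two chips.\<close>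

lemma card_fire:
  assumes K: "config_on N K" and abc: "a \<in> K v" "b \<in> K v" "c \<in> K v" "a < b" "b < c"
  shows "int (card (fire v a b c K w)) = int (card (K w)) + of_bool (w = left_child v)
    + of_bool (w = right_child v) + of_bool (w = parent v) - 3 * of_bool (w = v)"
proof -
  have d: "x \<in> K u \<Longrightarrow> x \<in> K w \<Longrightarrow> u = w" for x u w
    using K by (rule config_on_disjoint)
  have fin: "finite (K u)" for u using K by (rule config_on_finite)
  have sub: "{a, b, c} \<subseteq> K v" and c3: "card {a, b, c} = 3" using abc by auto
  have rem: "int (card (K v - {a, b, c})) = int (card (K v)) - 3"
    using card_Diff_subset[OF _ sub] card_mono[OF fin sub] c3 by simp
  show ?thesis
  proof (cases "w = v")
    case True
    show ?thesis
    proof (cases "v = []")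
      case True
      have "fire v a b c K w = insert b (K v - {a, b, c})"
        using True \<open>w = v\<close> unfolding fire_def by (auto simp: left_child_def right_child_def)
      hence "int (card (fire v a b c K w)) = int (card (K v - {a, b, c})) + 1"
        using fin by simp
      thus ?thesis using rem True \<open>w = v\<close> by (auto simp: left_child_def right_child_def)
    next
      case False
      have "fire v a b c K w = K v - {a, b, c}"
        using False \<open>w = v\<close> parent_eq_self_iff[of v] unfolding fire_def by auto
      thus ?thesis using rem False \<open>w = v\<close> parent_eq_self_iff[of v] by auto
    qed
  next
    case False
    have n: "a \<notin> K w" "b \<notin> K w" "c \<notin> K w" using abc d False by blast+
    consider "w = left_child v" | "w = right_child v" | "w = parent v"
      | "w \<noteq> left_child v" "w \<noteq> right_child v" "w \<noteq> parent v" by blast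
    thus ?thesis
      by cases (use False n fin in \<open>auto simp: fire_def\<close>)
  qed
qed

section \<open>Runs\<close>

text \<open>Everything is indexed by time so that fires can be counted from the end; nothing is
  assumed about the functions beyond time \<open>T\<close>.\<close>

locale chip_run =
  fixes m T :: nat and C :: "nat \<Rightarrow> config" and fv :: "nat \<Rightarrow> vertex"
    and ca cb cc :: "nat \<Rightarrow> nat"
  assumes initial: "C 0 = initial_config (2 ^ m - 1)"
    and step: "\<And>n. n < T \<Longrightarrow> C (Suc n) = fire (fv n) (ca n) (cb n) (cc n) (C n)"
    and ca_in: "\<And>n. n < T \<Longrightarrow> ca n \<in> C n (fv n)"
    and cb_in: "\<And>n. n < T \<Longrightarrow> cb n \<in> C n (fv n)"
    and cc_in: "\<And>n. n < T \<Longrightarrow> cc n \<in> C n (fv n)"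
    and ca_less: "\<And>n. n < T \<Longrightarrow> ca n < cb n"
    and cb_less: "\<And>n. n < T \<Longrightarrow> cb n < cc n"
    and stable_end: "stable (C T)"
    and m_pos: "0 < m"

lemma stable_configs_run:
  assumes "K \<in> stable_configs (2 ^ m - 1)" "0 < m"
  obtains T C fv ca cb cc where "chip_run m T C fv ca cb cc" "C T = K"
proof -
  have "fires\<^sup>*\<^sup>* (initial_config (2 ^ m - 1)) K" and st: "stable K"
    using assms(1) by (auto simp: stable_configs_def)
  then obtain T where "(fires ^^ T) (initial_config (2 ^ m - 1)) K"
    using rtranclp_imp_relpowp by metis
  then obtain C where C: "C 0 = initial_config (2 ^ m - 1)" "C T = K"
    and f: "\<forall>n<T. fires (C n) (C (Suc n))"
    unfolding relpowp_fun_conv by blast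
  have "\<forall>n. \<exists>q. n < T \<longrightarrow> (case q of (v, a, b, c) \<Rightarrow>
      a \<in> C n v \<and> b \<in> C n v \<and> c \<in> C n v \<and> a < b \<and> b < c \<and> C (Suc n) = fire v a b c (C n))"
  proof
    fix n
    show "\<exists>q. n < T \<longrightarrow> (case q of (v, a, b, c) \<Rightarrow>
      a \<in> C n v \<and> b \<in> C n v \<and> c \<in> C n v \<and> a < b \<and> b < c \<and> C (Suc n) = fire v a b c (C n))"
    proof (cases "n < T")
      case True
      with f have "fires (C n) (C (Suc n))" by blast
      thus ?thesis by (cases rule: fires.cases) auto
    qed auto
  qed
  from choice[OF this] obtain q where q: "\<forall>n. n < T \<longrightarrow> (case q n of (v, a, b, c) \<Rightarrow>
      a \<in> C n v \<and> b \<in> C n v \<and> c \<in> C n v \<and> a < b \<and> b < c \<and> C (Suc n) = fire v a b c (C n))"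
    by (rule exE)
  have "chip_run m T C (\<lambda>n. fst (q n)) (\<lambda>n. fst (snd (q n))) (\<lambda>n. fst (snd (snd (q n))))
      (\<lambda>n. snd (snd (snd (q n))))"
    by unfold_locales (use C st q assms(2) in \<open>auto simp: split_beta\<close>)
  thus thesis using C(2) by (rule that)
qed

context chip_run
begin

lemma config_on_run: "n \<le> T \<Longrightarrow> config_on (2 ^ m - 1) (C n)"
proof (induction n)
  case 0
  show ?case by (simp add: initial config_on_initial)
next
  case (Suc n)
  thus ?case using config_on_fire ca_in cb_in cc_in ca_less cb_less step by simp
qed

lemma finite_run: "n \<le> T \<Longrightarrow> finite (C n v)"
  using config_on_run config_on_finite by blast

lemma disjoint_run: "n \<le> T \<Longrightarrow> x \<in> C n v \<Longrightarrow> x \<in> C n w \<Longrightarrow> v = w"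
  using config_on_run config_on_disjoint by blast

section \<open>Fire counts and the odometer\<close>

definition fired :: "nat \<Rightarrow> vertex \<Rightarrow> nat" where
  "fired n v = card {i. i < n \<and> fv i = v}"

definition rem :: "nat \<Rightarrow> vertex \<Rightarrow> nat" where
  "rem n v = card {i. n \<le> i \<and> i < T \<and> fv i = v}"

lemma fired_0 [simp]: "fired 0 v = 0"
  by (simp add: fired_def)

lemma fired_Suc: "fired (Suc n) v = fired n v + of_bool (fv n = v)"
proof -
  have "{i. i < Suc n \<and> fv i = v} = {i. i < n \<and> fv i = v} \<union> (if fv n = v then {n} else {})"
    by (auto simp: less_Suc_eq)
  thus ?thesis by (auto simp: fired_def)
qed

lemma fired_rem: "n \<le> T \<Longrightarrow> fired n v + rem n v = fired T v"
proof -
  assume "n \<le> T"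
  hence "{i. i < T \<and> fv i = v} = {i. i < n \<and> fv i = v} \<union> {i. n \<le> i \<and> i < T \<and> fv i = v}"
    by auto
  moreover have "{i. i < n \<and> fv i = v} \<inter> {i. n \<le> i \<and> i < T \<and> fv i = v} = {}" by auto
  moreover have "finite {i. i < n \<and> fv i = v}" "finite {i. n \<le> i \<and> i < T \<and> fv i = v}" by simp_all
  ultimately show ?thesis unfolding fired_def rem_def by (simp add: card_Un_disjoint)
qed

lemma rem_Suc: "n < T \<Longrightarrow> rem n v = rem (Suc n) v + of_bool (fv n = v)"
  using fired_rem[of n v] fired_rem[of "Suc n" v] fired_Suc[of n v] by simp

lemma rem_T [simp]: "rem T v = 0"
  using fired_rem[of T v] by simp

lemma rem_antimono: "n \<le> n' \<Longrightarrow> rem n' v \<le> rem n v"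
  unfolding rem_def by (rule card_mono) auto

lemma card_run:
  assumes "n \<le> T"
  shows "int (card (C n w)) = (if w = [] then 2 ^ m - 1 else 0)
    + int (fired n (w @ [False])) + int (fired n (w @ [True])) + int (fired n (parent w))
    - 3 * int (fired n w)"
  using assms
proof (induction n)
  case 0
  show ?case by (simp add: initial initial_config_def of_nat_diff)
next
  case (Suc n)
  have "of_bool (w = left_child v) + of_bool (w = right_child v) + of_bool (w = parent v)
     = (of_bool (v = w @ [False]) + of_bool (v = w @ [True]) + of_bool (v = parent w) :: int)" for v
  proof (cases w rule: rev_cases)
    case Nil
    thus ?thesis
      by (cases v rule: rev_cases) (auto simp: left_child_def right_child_def)
  next
    case (snoc u d)
    thus ?thesis
      by (cases v rule: rev_cases) (auto simp: left_child_def right_child_def)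
  qed
  from this[of "fv n"]
  have "int (card (C (Suc n) w)) = int (card (C n w)) + of_bool (fv n = w @ [False])
      + of_bool (fv n = w @ [True]) + of_bool (fv n = parent w) - 3 * of_bool (fv n = w)"
    using Suc.prems card_fire[OF config_on_run[of n] ca_in[of n] cb_in[of n] cc_in[of n]
        ca_less[of n] cb_less[of n], of w] step[of n]
    by (simp add: eq_commute[of w "fv n"])
  moreover have "int (fired (Suc n) u) = int (fired n u) + of_bool (fv n = u)" for u
    by (simp add: fired_Suc)
  ultimately show ?case using Suc by simp
qed

text \<open>With \<open>d = m - k\<close>, the function \<open>2 ^ d - d - 1\<close> vanishes at
  \<open>d = 0\<close> and \<open>d = 1\<close> and solves the recurrence in
  \<open>odometer_balance\<close>, which says that these numbers of fires leave one chip on each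
  vertex of depth below \<open>m\<close>. Truncated subtraction makes it zero at all greater
  depths.\<close>

definition odometer :: "nat \<Rightarrow> int" where
  "odometer k = 2 ^ (m - k) - int (m - k) - 1"

lemma odometer_ge: "int (m - k) - 1 \<le> odometer k"
proof -
  have "2 * int d \<le> 2 ^ d" for d
    by (induction d) (auto simp: field_simps, smt (verit) one_le_power self_le_power)
  from this[of "m - k"] show ?thesis unfolding odometer_def by simp
qed

lemma odometer_nonneg: "0 \<le> odometer k"
proof (cases "m - k")
  case 0 thus ?thesis by (simp add: odometer_def)
next
  case (Suc d) thus ?thesis using odometer_ge[of k] by simp
qed

lemma odometer_outside: "m \<le> Suc k \<Longrightarrow> odometer k = 0"
  unfolding odometer_def by (cases "m = Suc k") auto

lemma odometer_balance:
  "(if w = [] then 2 ^ m - 1 else 0) + 2 * odometer (Suc (length w)) + odometer (length (parent w))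
     - 3 * odometer (length w) = of_bool (length w < m)"
proof (cases w rule: rev_cases)
  case Nil
  from m_pos obtain d where "m = Suc d" by (cases m) auto
  thus ?thesis unfolding odometer_def using Nil by simp
next
  case (snoc u e)
  consider "m \<le> length u" | "m = Suc (length u)" | d where "m = Suc (Suc (length u + d))"
    using le_Suc_ex[of "Suc (Suc (length u))" m] by fastforce
  thus ?thesis
    unfolding odometer_def by cases (use snoc in \<open>auto simp: Suc_diff_le\<close>)
qed

text \<open>Least action: if a vertex that has used up its odometer were to fire while no other
  vertex exceeds its own, the balance equation would leave it at most one chip.\<close>

lemma fired_le: "n \<le> T \<Longrightarrow> int (fired n v) \<le> odometer (length v)"
proof (induction n arbitrary: v)
  case 0
  show ?case by (simp add: odometer_nonneg)
next
  case (Suc n)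
  hence n: "n < T" and IH: "\<And>v. int (fired n v) \<le> odometer (length v)" by auto
  show ?case
  proof (cases "fv n = v")
    case True
    have "{ca n, cb n, cc n} \<subseteq> C n v" "card {ca n, cb n, cc n} = 3"
      using ca_in[OF n] cb_in[OF n] cc_in[OF n] ca_less[OF n] cb_less[OF n] True by auto
    hence "3 \<le> card (C n v)" using card_mono finite_run n by (metis less_imp_le)
    moreover have "int (card (C n v)) \<le> of_bool (length v < m) + 3 * (odometer (length v) - fired n v)"
      using card_run[of n v] n IH[of "v @ [False]"] IH[of "v @ [True]"] IH[of "parent v"]
        odometer_balance[of v] by auto
    ultimately have "int (fired n v) < odometer (length v)"
      by (cases "length v < m") auto
    thus ?thesis using True by (simp add: fired_Suc)
  next
    case False
    thus ?thesis using IH by (simp add: fired_Suc)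
  qed
qed

lemma finite_short: "finite {v :: vertex. length v < k}"
  using finite_lists_length_le[of "UNIV :: bool set" k]
  by (rule finite_subset[rotated]) auto

text \<open>
  The unspent part of the odometer has no positive maximum: at a deepest maximum the balance
  equation would force three chips.
\<close>

lemma fired_eq: "int (fired T v) = odometer (length v)"
proof (rule ccontr)
  define h where "h v = odometer (length v) - int (fired T v)" for v :: vertex
  have h0: "0 \<le> h v" for v using fired_le[of T v] by (simp add: h_def)
  have hout: "h v = 0" if "m \<le> length v" for v
    using fired_le[of T v] odometer_outside[of "length v"] that by (simp add: h_def)
  assume "int (fired T v) \<noteq> odometer (length v)"
  hence v: "0 < h v" using h0[of v] by (simp add: h_def)
  \<comment> \<open>Maximizing this weight maximizes \<open>h\<close> first and depth second, since
    depths below \<open>m\<close> cannot compensate a difference of one in \<open>h\<close>.\<close>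
  define \<phi> where "\<phi> u = h u * (int m + 1) + int (length u)" for u :: vertex
  have "v \<in> {v. length v < m}" using v hout[of v] by force
  hence "Max (\<phi> ` {v. length v < m}) \<in> \<phi> ` {v. length v < m}"
    using finite_short[of m] by (intro Max_in) auto
  then obtain w where w: "length w < m" "\<phi> w = Max (\<phi> ` {v. length v < m})" by auto
  have max: "\<phi> u \<le> \<phi> w" if "length u < m" for u
    using that w(2) finite_short[of m] by simp
  have le: "h u \<le> h w" for u
  proof (cases "length u < m")
    case True
    have "\<not> h w + 1 \<le> h u"
    proof
      assume "h w + 1 \<le> h u"
      hence "(h w + 1) * (int m + 1) \<le> h u * (int m + 1)" by (intro mult_right_mono) auto
      thus False using max[OF True] w(1) True by (simp add: \<phi>_def algebra_simps)
    qed
    thus ?thesis by simp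
  next
    case False
    thus ?thesis using hout h0 by simp
  qed
  have hw: "0 < h w" using v le[of v] by simp
  have less: "h u \<le> h w - 1" if "length u = Suc (length w)" for u
  proof (cases "length u < m")
    case True
    have "h u \<noteq> h w" using max[OF True] that by (auto simp: \<phi>_def)
    thus ?thesis using le[of u] by simp
  next
    case False
    thus ?thesis using hout[of u] hw by simp
  qed
  have "int (card (C T w)) = 1 + 3 * h w - h (w @ [False]) - h (w @ [True]) - h (parent w)"
    using card_run[of T w] odometer_balance[of w] w(1) by (simp add: h_def)
  hence "3 \<le> card (C T w)" using less[of "w @ [False]"] less[of "w @ [True]"] le[of "parent w"] by simp
  thus False using stable_end by (simp add: stable_def not_less[symmetric])
qed

lemma fired_int: "n \<le> T \<Longrightarrow> int (fired n v) = odometer (length v) - int (rem n v)"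
  using fired_rem[of n v] fired_eq[of v] by simp

lemma card_rem:
  assumes "n \<le> T"
  shows "int (card (C n w)) = of_bool (length w < m) + 3 * int (rem n w)
     - int (rem n (w @ [False])) - int (rem n (w @ [True])) - int (rem n (parent w))"
  using card_run[OF assms, of w] fired_int[OF assms] odometer_balance[of w] by simp

lemma card_final: "card (C T v) = of_bool (length v < m)"
  using card_rem[of T v] by (auto split: if_splits)

lemma rem_0: "int (rem 0 v) = odometer (length v)"
  using fired_int[of 0 v] by simp

end

section \<open>The last fires of a vertex\<close>

context chip_run
begin

text \<open>Suppose \<open>v\<close> fired too early, with \<open>Suc t\<close> fires left. Its
  parent would still have at least \<open>t + 2\<close> left and, by induction on \<open>t\<close>,
  each child of \<open>v\<close> at least \<open>t\<close>, so \<open>card_rem\<close> would leave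
  \<open>v\<close> at most two chips. The condition on \<open>m\<close> makes the odometer large
  enough at time \<open>0\<close>.\<close>

lemma rem_child_ge:
  assumes "n \<le> T" "v \<noteq> []" "t + length v < m" "t < rem n (parent v)"
  shows "t \<le> rem n v"
  using assms
proof (induction t arbitrary: n v)
  case 0
  show ?case by simp
next
  case (Suc t)
  note IHt = Suc.IH and v = \<open>v \<noteq> []\<close> and tm = \<open>Suc t + length v < m\<close>
  show ?case using \<open>n \<le> T\<close> \<open>Suc t < rem n (parent v)\<close>
  proof (induction n)
    case 0
    show ?case using rem_0[of v] odometer_ge[of "length v"] tm by simp
  next
    case (Suc n)
    hence n: "n < T" by simp
    have le: "rem (Suc n) (parent v) \<le> rem n (parent v)" by (rule rem_antimono) simp
    have ge: "Suc t \<le> rem n v" using Suc le by simp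
    show ?case
    proof (rule ccontr)
      assume "\<not> Suc t \<le> rem (Suc n) v"
      hence eq: "rem n v = Suc t" and fv: "fv n = v"
        using ge rem_Suc[OF n, of v] by (cases "fv n = v"; simp)+
      have "t \<le> rem n (v @ [d])" for d
        by (rule IHt) (use n tm eq in auto)
      from this[of False] this[of True]
      have "int (card (C n v)) \<le> 2"
        using card_rem[of n v] n eq le Suc.prems tm by simp
      moreover have "{ca n, cb n, cc n} \<subseteq> C n v" "card {ca n, cb n, cc n} = 3"
        using ca_in[OF n] cb_in[OF n] cc_in[OF n] ca_less[OF n] cb_less[OF n] fv by auto
      hence "3 \<le> card (C n v)" using card_mono finite_run n by (metis less_imp_le)
      ultimately show False by simp
    qed
  qed
qed

text \<open>\<open>event n v t\<close>: the fire at time \<open>n\<close> is the \<open>t\<close>-th fire of \<open>v\<close>, counted from the last one.\<close>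

definition event :: "nat \<Rightarrow> vertex \<Rightarrow> nat \<Rightarrow> bool" where
  "event n v t \<longleftrightarrow> n < T \<and> fv n = v \<and> rem n v = t"

lemma eventD: "event n v t \<Longrightarrow> n < T \<and> fv n = v \<and> rem n v = t \<and> rem (Suc n) v = t - 1 \<and> 0 < t"
  using rem_Suc[of n v] unfolding event_def by auto

lemma event_between:
  assumes "n1 \<le> n2" "n2 \<le> T" "rem n2 v < t" "t \<le> rem n1 v"
  shows "\<exists>n. n1 \<le> n \<and> n < n2 \<and> event n v t"
  using assms
proof (induction n2 rule: dec_induct)
  case base
  thus ?case by simp
next
  case (step n)
  show ?case
  proof (cases "rem n v < t")
    case True
    thus ?thesis using step by (metis Suc_leD less_SucI)
  next
    case False
    hence "event n v t" using step rem_Suc[of n v] unfolding event_def by (cases "fv n = v") auto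
    thus ?thesis using step by auto
  qed
qed

lemma event_exists:
  assumes "0 < t" "t + length v < m"
  shows "\<exists>n. event n v t"
proof -
  have "t \<le> rem 0 v" using rem_0[of v] odometer_ge[of "length v"] assms by simp
  thus ?thesis using event_between[of 0 T v t] assms by auto
qed

lemma fired_chips:
  "n < T \<Longrightarrow> {ca n, cb n, cc n} \<subseteq> C n (fv n) \<and> card {ca n, cb n, cc n} = 3"
  using ca_in[of n] cb_in[of n] cc_in[of n] ca_less[of n] cb_less[of n] by auto

text \<open>Once the children have at least \<open>t - 1\<close> fires left and the parent exactly
  \<open>t\<close>, \<open>card_rem\<close> allows at most three chips, and a fire needs three, so
  equality holds throughout. The parent has no more than \<open>t\<close> left by
  \<open>rem_child_ge\<close> just after the fire, and no fewer because, by induction on depth,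
  \<open>v\<close> has only \<open>t - 1\<close> left at the \<open>t\<close>-th last fire of the
  parent.\<close>

lemma event_exact:
  assumes "event n v t" "t + length v < m"
  shows "(\<forall>d. rem n (v @ [d]) = t - 1) \<and> (v \<noteq> [] \<longrightarrow> rem n (parent v) = t)
    \<and> C n v = {ca n, cb n, cc n}"
  using assms
proof (induction "length v" arbitrary: n v t)
  case 0
  hence v: "v = []" by simp
  have ev: "n < T" "fv n = v" "rem n v = t" "0 < t" using 0 eventD by auto
  have ge: "t - 1 \<le> rem n (v @ [d])" for d
    by (rule rem_child_ge) (use ev 0 v in \<open>auto simp: parent_def\<close>)
  have sub: "{ca n, cb n, cc n} \<subseteq> C n v" and c3: "card {ca n, cb n, cc n} = 3"
    using fired_chips[of n] ev by auto
  have fin: "finite (C n v)" using finite_run ev by simp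
  have "3 \<le> card (C n v)" using card_mono[OF fin sub] c3 by simp
  moreover have "int (card (C n v)) = 1 + 2 * int t - int (rem n (v @ [False])) - int (rem n (v @ [True]))"
    using card_rem[of n v] ev 0 v by simp
  ultimately have "rem n (v @ [False]) = t - 1" "rem n (v @ [True]) = t - 1" "card (C n v) = 3"
    using ge[of False] ge[of True] ev by auto
  moreover from this have "C n v = {ca n, cb n, cc n}"
    using card_subset_eq[OF fin sub] c3 by simp
  ultimately show ?case using v by (metis (full_types))
next
  case (Suc k)
  then obtain p e where v: "v = p @ [e]" and k: "k = length p"
    by (metis length_append_singleton length_Suc_conv_rev nat.inject)
  have ev: "n < T" "fv n = v" "rem n v = t" "0 < t" "rem (Suc n) v = t - 1"
    using Suc eventD by auto
  have ge: "t - 1 \<le> rem n (v @ [d])" for d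
    by (rule rem_child_ge) (use ev Suc in auto)
  have le: "rem n p \<le> t"
  proof (rule ccontr)
    assume "\<not> rem n p \<le> t"
    hence "t < rem (Suc n) (parent v)" using rem_Suc[of n p] ev v by simp
    hence "t \<le> rem (Suc n) v"
      by (intro rem_child_ge) (use ev Suc v in auto)
    thus False using ev by simp
  qed
  have "t \<le> rem n p"
  proof (rule ccontr)
    assume a: "\<not> t \<le> rem n p"
    have "t \<le> rem 0 p" using rem_0[of p] odometer_ge[of "length p"] Suc.prems v by simp
    then obtain n' where n': "n' < n" "event n' p t"
      using event_between[of 0 n p t] a ev by auto
    have "rem n' v = t - 1" using Suc.hyps(1)[OF k n'(2)] Suc.prems v by auto
    thus False using rem_antimono[of n' n v] n' ev by simp
  qed
  with le have p: "rem n p = t" by simp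
  have sub: "{ca n, cb n, cc n} \<subseteq> C n v" and c3: "card {ca n, cb n, cc n} = 3"
    using fired_chips[of n] ev by auto
  have fin: "finite (C n v)" using finite_run ev by simp
  have "3 \<le> card (C n v)" using card_mono[OF fin sub] c3 by simp
  moreover have "int (card (C n v)) = 1 + 2 * int t - int (rem n (v @ [False])) - int (rem n (v @ [True]))"
    using card_rem[of n v] ev Suc.prems v p by simp
  ultimately have "rem n (v @ [False]) = t - 1" "rem n (v @ [True]) = t - 1" "card (C n v) = 3"
    using ge[of False] ge[of True] ev by auto
  moreover from this have "C n v = {ca n, cb n, cc n}"
    using card_subset_eq[OF fin sub] c3 by simp
  ultimately show ?case using p v by (metis (full_types) parent_snoc)
qed

lemmas event_rem_child = event_exact[THEN conjunct1, rule_format]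
lemmas event_chips = event_exact[THEN conjunct2, THEN conjunct2]

lemma event_rem_parent: "event n (p @ [d]) t \<Longrightarrow> t + length p + 1 < m \<Longrightarrow> rem n p = t"
  using event_exact[of n "p @ [d]" t] by simp

lemma chip_stays:
  assumes "n \<le> n'" "n' \<le> T" "x \<in> C n v" "rem n v = rem n' v"
  shows "x \<in> C n' v"
  using assms
proof (induction n' rule: dec_induct)
  case base
  thus ?case by simp
next
  case (step i)
  have "rem n v = rem i v" using rem_antimono[of n i v] rem_antimono[of i "Suc i" v] step by simp
  moreover from this have "fv i \<noteq> v" using rem_Suc[of i v] step by auto
  ultimately show ?case using step chip_run.step[OF chip_run_axioms, of i]
    by (simp add: mem_fire_iff)
qed

lemma fired_children:
  assumes "n < T"
  shows "ca n \<in> C (Suc n) (fv n @ [False])" "cc n \<in> C (Suc n) (fv n @ [True])"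
    "cb n \<in> C (Suc n) (parent (fv n))"
  using step[OF assms] by (simp_all add: mem_fire_iff left_child_def right_child_def)

lemma event_parent_before:
  assumes "event n1 p (Suc t)" "event n2 (p @ [d]) t" "t + length p + 1 < m"
  shows "n1 < n2"
proof (rule ccontr)
  assume "\<not> n1 < n2"
  hence "rem n1 p \<le> rem n2 p" by (intro rem_antimono) simp
  thus False using event_rem_parent[OF assms(2,3)] eventD[OF assms(1)] by simp
qed

text \<open>The left child does not fire between the two events, so a chip sent down in wave
  \<open>Suc t\<close> is among the three chips it fires in wave \<open>t\<close>.\<close>

lemma ca_arrives:
  assumes "event n1 p (Suc t)" "event n2 (p @ [False]) t" "t + length p + 1 < m"
  shows "ca n1 \<in> C n2 (p @ [False])"
proof (rule chip_stays)
  show "Suc n1 \<le> n2" using event_parent_before[OF assms] by simp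
  show "n2 \<le> T" "ca n1 \<in> C (Suc n1) (p @ [False])"
    using eventD[OF assms(1)] eventD[OF assms(2)] fired_children(1)[of n1] by auto
  have "rem n1 (p @ [False]) = t" using event_rem_child[OF assms(1)] assms(3) by simp
  thus "rem (Suc n1) (p @ [False]) = rem n2 (p @ [False])"
    using eventD[OF assms(1)] eventD[OF assms(2)] rem_Suc[of n1 "p @ [False]"] by simp
qed

text \<open>Waves run upwards: a chip sent up is fired again by the parent within the same
  wave.\<close>

lemma cb_arrives:
  assumes "event n1 (p @ [d]) t" "event n2 p t" "t + length p + 1 < m"
  shows "n1 < n2" "cb n1 \<in> C n2 p"
proof -
  have r1: "rem n1 p = t" using event_rem_parent[OF assms(1,3)] .
  have r2: "rem n2 (p @ [d]) = t - 1" using event_rem_child[OF assms(2)] assms(3) by simp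
  show less: "n1 < n2"
  proof (rule ccontr)
    assume "\<not> n1 < n2"
    hence "rem n1 (p @ [d]) \<le> rem n2 (p @ [d])" by (intro rem_antimono) simp
    thus False using eventD[OF assms(1)] r2 by auto
  qed
  show "cb n1 \<in> C n2 p"
  proof (rule chip_stays)
    show "Suc n1 \<le> n2" using less by simp
    show "n2 \<le> T" "cb n1 \<in> C (Suc n1) p"
      using eventD[OF assms(1)] eventD[OF assms(2)] fired_children(3)[of n1] by auto
    show "rem (Suc n1) p = rem n2 p"
      using eventD[OF assms(1)] eventD[OF assms(2)] rem_Suc[of n1 p] r1 by auto
  qed
qed

lemma chip_bounds:
  assumes "event n v t" "t + length v < m" "x \<in> C n v"
  shows "ca n \<le> x" "x \<le> cc n"
proof -
  have "x \<in> {ca n, cb n, cc n}" using event_chips[OF assms(1,2)] assms(3) by simp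
  thus "ca n \<le> x" "x \<le> cc n"
    using eventD[OF assms(1)] ca_less[of n] cb_less[of n] by auto
qed

section \<open>The final configuration\<close>

definition fin :: "vertex \<Rightarrow> nat" where
  "fin v = the_elem (C T v)"

lemma final_eq: "C T v = (if length v < m then {fin v} else {})"
proof (cases "length v < m")
  case True
  hence "card (C T v) = 1" using card_final[of v] by simp
  then obtain x where "C T v = {x}" by (auto simp: card_1_singleton_iff)
  thus ?thesis using True by (simp add: fin_def)
next
  case False
  hence "card (C T v) = 0" using card_final[of v] by simp
  thus ?thesis using False finite_run[of T v] by simp
qed

lemma fin_eqI: "x \<in> C T v \<Longrightarrow> fin v = x"
  using final_eq[of v] by (auto split: if_splits)

lemma fin_left:
  assumes "event n v 1" "length v + 1 < m"
  shows "fin (v @ [False]) = ca n"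
proof (rule fin_eqI, rule chip_stays)
  show "Suc n \<le> T" "T \<le> T" "ca n \<in> C (Suc n) (v @ [False])"
    using eventD[OF assms(1)] fired_children(1)[of n] by auto
  show "rem (Suc n) (v @ [False]) = rem T (v @ [False])"
    using event_rem_child[OF assms(1), of False] assms(2) rem_antimono[of n "Suc n" "v @ [False]"] by simp
qed

lemma fin_right:
  assumes "event n v 1" "length v + 1 < m"
  shows "fin (v @ [True]) = cc n"
proof (rule fin_eqI, rule chip_stays)
  show "Suc n \<le> T" "T \<le> T" "cc n \<in> C (Suc n) (v @ [True])"
    using eventD[OF assms(1)] fired_children(2)[of n] by auto
  show "rem (Suc n) (v @ [True]) = rem T (v @ [True])"
    using event_rem_child[OF assms(1), of True] assms(2) rem_antimono[of n "Suc n" "v @ [True]"] by simp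
qed

lemma fin_root:
  assumes "event n [] 1" "1 < m"
  shows "fin [] = cb n"
proof (rule fin_eqI, rule chip_stays)
  show "Suc n \<le> T" "T \<le> T" "cb n \<in> C (Suc n) []"
    using eventD[OF assms(1)] fired_children(3)[of n] by auto
  show "rem (Suc n) [] = rem T []"
    using eventD[OF assms(1)] by simp
qed

text \<open>The chip sent to the left is one of the three chips of the next fire down the chain, and
  the smallest of those is passed on, so the chips sent down can only decrease.\<close>

lemma fin_leftmost_le:
  assumes "event n u t" "t + length u < m"
  shows "fin (u @ replicate t False) \<le> ca n"
  using assms
proof (induction t arbitrary: n u)
  case 0
  thus ?case using eventD by blast
next
  case (Suc t)
  show ?case
  proof (cases "t = 0")
    case True
    thus ?thesis using Suc.prems fin_left[of n u] by simp
  next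
    case False
    then obtain n' where n': "event n' (u @ [False]) t"
      using event_exists[of t "u @ [False]"] Suc.prems by auto
    have "ca n' \<le> ca n"
      using chip_bounds(1)[OF n'] ca_arrives[OF Suc.prems(1) n'] Suc.prems(2) by simp
    moreover have "fin ((u @ [False]) @ replicate t False) \<le> ca n'"
      using Suc.IH[OF n'] Suc.prems by simp
    ultimately show ?thesis by simp
  qed
qed

text \<open>In its last fire \<open>v\<close> sends its middle chip to \<open>p\<close>, where it
  takes part in the last fire of \<open>p\<close>. The smallest chip of that fire becomes the final
  chip of \<open>v\<close>, so it is at most the middle chip, which is below the chip that
  \<open>v\<close> sent to the right.\<close>

lemma fin_less_fin_right:
  assumes "length v + 2 \<le> m" "v = p @ [False]"
  shows "fin v < fin (v @ [True])"
proof -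
  obtain n1 where n1: "event n1 v 1" using event_exists[of 1 v] assms by auto
  obtain n2 where n2: "event n2 p 1" using event_exists[of 1 p] assms by auto
  have "cb n1 \<in> C n2 p" using cb_arrives(2)[of n1 p False 1 n2] n1 n2 assms by simp
  hence "ca n2 \<le> cb n1" using chip_bounds(1)[OF n2] assms by simp
  thus ?thesis using fin_left[OF n2] fin_right[OF n1] cb_less[of n1] eventD[OF n1] assms by simp
qed

lemma fin_left_less_fin_root:
  assumes "2 \<le> m"
  shows "fin [False] < fin []"
proof -
  obtain n where n: "event n [] 1" using event_exists[of 1 "[]"] assms by auto
  show ?thesis using fin_left[OF n] fin_root[OF n] ca_less[of n] eventD[OF n] assms by simp
qed

section \<open>Chips of a final subtree below a threshold\<close>

definition sub :: "nat \<Rightarrow> vertex \<Rightarrow> nat set" where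
  "sub n u = subtree_chips (C n) u"

definition below :: "vertex \<Rightarrow> nat \<Rightarrow> nat" where
  "below u x = card {y \<in> sub T u. y < x}"

lemma mem_sub_iff: "x \<in> sub n u \<longleftrightarrow> (\<exists>w. x \<in> C n (u @ w))"
  by (simp add: sub_def subtree_chips_def)

lemma finite_sub: "n \<le> T \<Longrightarrow> finite (sub n u)"
proof (rule finite_subset)
  assume n: "n \<le> T"
  show "sub n u \<subseteq> {1..2 ^ m - 1}"
  proof
    fix x assume "x \<in> sub n u"
    then obtain w where "x \<in> C n (u @ w)" by (auto simp: mem_sub_iff)
    thus "x \<in> {1..2 ^ m - 1}" using config_on_range[OF config_on_run[OF n]] by auto
  qed
qed simp

lemma sub_append_subset: "sub n (u @ w) \<subseteq> sub n u"
  by (auto simp: mem_sub_iff)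

lemma below_append_le: "below (u @ w) x \<le> below u x"
  unfolding below_def using sub_append_subset[of T u w] finite_sub[of T u] by (intro card_mono) auto

lemma fin_in_sub: "length u < m \<Longrightarrow> fin u \<in> sub T u"
  unfolding mem_sub_iff using final_eq[of u] by (auto intro: exI[of _ "[]"])

lemma sub_split: "sub n u = C n u \<union> sub n (u @ [False]) \<union> sub n (u @ [True])"
proof -
  have "(\<exists>w. x \<in> C n (u @ w)) \<longleftrightarrow> x \<in> C n u \<or> (\<exists>w. x \<in> C n (u @ False # w)) \<or> (\<exists>w. x \<in> C n (u @ True # w))" for x
    by (metis (full_types) append_Nil2 neq_Nil_conv)
  thus ?thesis by (auto simp: mem_sub_iff)
qed

lemma root_notin_sub: "n \<le> T \<Longrightarrow> x \<in> C n u \<Longrightarrow> x \<notin> sub n (u @ [d])"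
proof
  assume "n \<le> T" "x \<in> C n u" "x \<in> sub n (u @ [d])"
  then obtain w where "x \<in> C n (u @ [d] @ w)" by (auto simp: mem_sub_iff)
  hence "u = u @ [d] @ w" using disjoint_run \<open>n \<le> T\<close> \<open>x \<in> C n u\<close> by blast
  thus False by simp
qed

end

section \<open>Tracing chips back under the ballot condition\<close>

locale ballot_run = chip_run +
  assumes ballot: "\<And>v x. length v + 1 < m \<Longrightarrow> below (v @ [True]) x \<le> below (v @ [False]) x"
begin

text \<open>The chip at the end of the left chain is below \<open>x\<close> by
  \<open>fin_leftmost_le\<close>, and \<open>R\<close> puts \<open>j\<close> further chips below
  it.\<close>

lemma below_leftmost_ge:
  assumes R: "\<And>v. length v + Suc j \<le> m \<Longrightarrow> j \<le> below v (fin v)"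
    and ev: "event n u t" and m: "length u + t + Suc j \<le> m" and x: "ca n < x"
  shows "Suc j \<le> below (u @ replicate t False) x"
proof -
  let ?w = "u @ replicate t False"
  have le: "fin ?w < x" using fin_leftmost_le[OF ev] m x by simp
  have mem: "fin ?w \<in> sub T ?w" using fin_in_sub m by simp
  have "j \<le> card {y \<in> sub T ?w. y < fin ?w}" using R[of ?w] m by (simp add: below_def)
  moreover have "card (insert (fin ?w) {y \<in> sub T ?w. y < fin ?w}) \<le> below ?w x"
    unfolding below_def using le mem finite_sub[of T ?w] by (intro card_mono) auto
  ultimately show ?thesis using finite_sub[of T ?w] by simp
qed

lemma chip_enters:
  assumes "n1 \<le> n2" "n2 \<le> T" "x \<in> C n2 p" "x \<notin> C n1 p"
  shows "\<exists>n. n1 \<le> n \<and> n < n2 \<and> x \<notin> C n p \<and> x \<in> C (Suc n) p"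
  using assms
proof (induction n2 rule: dec_induct)
  case base
  thus ?case by simp
next
  case (step n)
  show ?case
  proof (cases "x \<in> C n p")
    case True
    thus ?thesis using step by (metis Suc_leD less_SucI)
  next
    case False
    thus ?thesis using step by auto
  qed
qed

text \<open>
  The chip \<open>ca n\<close> that a left chain passes down in the wave \<open>s\<close> is traced upwards, wave by wave,
  until it is seen to come from a sibling subtree or to exceed a chip sent into the chain.
\<close>

lemma below_traced:
  assumes R: "\<And>v. length v + Suc j \<le> m \<Longrightarrow> j \<le> below v (fin v)"
    and transfer: "\<And>i x. 0 < i \<Longrightarrow> i < length v \<Longrightarrow> Suc j \<le> below (take i v) x
        \<Longrightarrow> take (Suc i) v = take i v @ [False] \<Longrightarrow> last (take i v) = False
        \<Longrightarrow> Suc j \<le> below (take (Suc i) v) x"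
    and m: "length v + Suc (Suc j) \<le> m"
    and ev: "event n p s" and v: "v = p @ replicate s False"
  shows "Suc j \<le> below v (ca n)"
  using ev v
proof (induction "length p" arbitrary: p s n rule: less_induct)
  case less
  note ev2 = \<open>event n p s\<close> and v = \<open>v = p @ replicate s False\<close>
  define x where "x = ca n"
  have lenv: "length v = length p + s" using v by simp
  have s: "0 < s" using eventD[OF ev2] by simp
  obtain n1 where ev1: "event n1 p (Suc s)"
    using event_exists[of "Suc s" p] lenv m by auto
  have "n1 < n"
  proof (rule ccontr)
    assume "\<not> n1 < n"
    hence "rem n1 p \<le> rem n p" by (intro rem_antimono) simp
    thus False using eventD[OF ev1] eventD[OF ev2] by simp
  qed
  have nT: "n < T" "n1 < T" using eventD[OF ev1] eventD[OF ev2] by auto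
  have xin: "x \<in> C n p" using ca_in[OF nT(1)] eventD[OF ev2] by (simp add: x_def)
  have rec: "replicate (Suc i) False = replicate i False @ [False]" for i
    by (simp add: replicate_append_same)
  \<comment> \<open>A wave whose number exceeds the length of the chain from \<open>u\<close> to
    \<open>v\<close> by one reaches \<open>v @ [False]\<close>, and the \<open>j + 1\<close> chips
    found there lie in the subtree of \<open>v\<close>.\<close>
  have deep: "Suc j \<le> below v y" if "event n' u (Suc t)" "u @ replicate t False = v" "ca n' < y" for n' u t y
  proof -
    have "length u + t = length v" using that(2) by auto
    hence "Suc j \<le> below (u @ replicate (Suc t) False) y"
      using below_leftmost_ge[OF R that(1) _ that(3)] m by simp
    also have "u @ replicate (Suc t) False = v @ [False]"
      unfolding rec using that(2) by simp
    finally show ?thesis using below_append_le[of v "[False]" y] by simp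
  qed
  show ?case unfolding x_def[symmetric]
  proof (cases "x \<in> C (Suc n1) p")
    case True
    have "C n1 p = {ca n1, cb n1, cc n1}" using event_chips[OF ev1] lenv m by simp
    \<comment> \<open>All three chips present at \<open>p\<close> are fired, so only the self-loop
      of the root can leave \<open>x\<close> where it was.\<close>
    hence "p = [] \<and> x = cb n1" using True step[OF nT(2)] eventD[OF ev1] parent_eq_self_iff[of p]
      by (auto simp: mem_fire_iff)
    hence "ca n1 < x" using ca_less[OF nT(2)] by simp
    thus "Suc j \<le> below v x" using deep[OF ev1] v by simp
  next
    case False
    then obtain i where i: "Suc n1 \<le> i" "i < n" "x \<notin> C i p" "x \<in> C (Suc i) p"
      using chip_enters[of "Suc n1" n x p] xin \<open>n1 < n\<close> nT by auto
    have iT: "i < T" using i nT by simp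
    have remp: "rem i p = s" "rem (Suc i) p = s"
      using rem_antimono[of "Suc n1" i p] rem_antimono[of i "Suc i" p] rem_antimono[of "Suc i" n p]
        i eventD[OF ev1] eventD[OF ev2] by auto
    hence fvi: "fv i \<noteq> p" using rem_Suc[OF iT, of p] by auto
    consider (left) "p = fv i @ [False]" "x = ca i" | (right) "p = fv i @ [True]" "x = cc i"
      | (up) d where "fv i = p @ [d]" "x = cb i"
    proof -
      have "p = left_child (fv i) \<and> x = ca i \<or> p = parent (fv i) \<and> x = cb i \<or> p = right_child (fv i) \<and> x = cc i"
        using i step[OF iT] by (auto simp: mem_fire_iff)
      moreover have "\<exists>d. fv i = p @ [d]" if "p = parent (fv i)"
        using that fvi by (cases "fv i" rule: rev_cases) auto
      ultimately show thesis using that unfolding left_child_def right_child_def by blast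
    qed
    thus "Suc j \<le> below v x"
    proof cases
      case up
      have "rem n1 (p @ [d]) = s" "rem n (p @ [d]) = s - 1"
        using event_rem_child[OF ev1] event_rem_child[OF ev2] lenv m by auto
      hence evi: "event i (p @ [d]) s"
        using rem_antimono[of n1 i "p @ [d]"] rem_antimono[of "Suc i" n "p @ [d]"] i iT up(1)
          rem_Suc[OF iT, of "p @ [d]"] s unfolding event_def by auto
      have lt: "ca i < x" using ca_less[OF iT] up by simp
      obtain s' where s': "s = Suc s'" using s by (cases s) auto
      show ?thesis
      proof (cases d)
        case False
        thus ?thesis using deep[of i "p @ [False]" s' x] evi lt s' v by simp
      next
        case True
        \<comment> \<open>The small chips are found on the wrong side of \<open>p\<close>. The
          ballot condition yields as many on the left side, and \<open>transfer\<close> carries them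
          down the chain to \<open>v\<close>.\<close>
        have "Suc j \<le> below ((p @ [True]) @ replicate s False) x"
          using below_leftmost_ge[OF R evi _ lt] lenv m True by simp
        hence "Suc j \<le> below (p @ [True]) x" using below_append_le le_trans by blast
        hence base: "Suc j \<le> below (p @ [False]) x" using ballot[of p x] lenv m s by simp
        have "Suc j \<le> below (take (length p + Suc i) v) x" if "i < s" for i
          using that
        proof (induction i)
          case 0
          thus ?case using base v s' by simp
        next
          case (Suc i)
          have t: "take (length p + k) v = p @ replicate k False" if "k \<le> s" for k
            using v that by (simp add: min_def)
          have "Suc j \<le> below (take (Suc (length p + Suc i)) v) x"
          proof (rule transfer)
            show "Suc j \<le> below (take (length p + Suc i) v) x" using Suc by simp
            show "take (Suc (length p + Suc i)) v = take (length p + Suc i) v @ [False]"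
              using t[of "Suc i"] t[of "Suc (Suc i)"] Suc.prems rec[of "Suc i"] by simp
            show "last (take (length p + Suc i) v) = False"
              using t[of "Suc i"] Suc.prems by simp
          qed (use lenv Suc.prems in auto)
          thus ?case by simp
        qed
        from this[of s'] show ?thesis using s' lenv by simp
      qed
    next
      case left
      have "rem n1 (fv i) = Suc s" "rem n (fv i) = s"
        using event_rem_parent[of n1 "fv i" False "Suc s"] event_rem_parent[of n "fv i" False s]
          ev1 ev2 left(1) lenv m by auto
      hence evi: "event i (fv i) (Suc s)"
        using rem_antimono[of n1 i "fv i"] rem_antimono[of "Suc i" n "fv i"] i iT
          rem_Suc[OF iT, of "fv i"] unfolding event_def by auto
      have "length (fv i) < length p" using left(1) by (metis length_append_singleton lessI)
      moreover have "v = fv i @ replicate (Suc s) False" using left(1) v by simp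
      ultimately show ?thesis using less.hyps[OF _ evi] left(2) by simp
    next
      case right
      have "rem n1 (fv i) = Suc s" "rem n (fv i) = s"
        using event_rem_parent[of n1 "fv i" True "Suc s"] event_rem_parent[of n "fv i" True s]
          ev1 ev2 right(1) lenv m by auto
      hence evi: "event i (fv i) (Suc s)"
        using rem_antimono[of n1 i "fv i"] rem_antimono[of "Suc i" n "fv i"] i iT
          rem_Suc[OF iT, of "fv i"] unfolding event_def by auto
      have len: "length p = Suc (length (fv i))" using right(1) by (metis length_append_singleton)
      \<comment> \<open>The middle chip that \<open>p\<close> sent up earlier in this wave takes
        part in the same fire, and \<open>x\<close> is the largest chip of that fire.\<close>
      have "cb n1 \<in> C i (fv i)"
        using cb_arrives(2)[of n1 "fv i" True "Suc s" i] ev1 evi right(1) lenv m len by simp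
      hence "cb n1 \<le> cc i" using chip_bounds(2)[OF evi] lenv m len by simp
      hence "ca n1 < x" using ca_less[OF nT(2)] right(2) by simp
      thus ?thesis using deep[OF ev1] v by simp
    qed
  qed
qed

end

context chip_run
begin

section \<open>Small chips in a subtree\<close>

text \<open>The only exit of a subtree is its root, and only the middle chip of a fire goes
  up.\<close>

lemma sub_step:
  assumes n: "n < T" and y: "y \<in> sub n w"
  shows "y \<in> sub (Suc n) w \<or> fv n = w \<and> y = cb n"
proof -
  obtain s where s: "y \<in> C n (w @ s)" using y by (auto simp: mem_sub_iff)
  show ?thesis
  proof (cases "fv n = w @ s \<and> (y = ca n \<or> y = cb n \<or> y = cc n)")
    case False
    hence "y \<in> C (Suc n) (w @ s)" using s step[OF n] by (auto simp: mem_fire_iff)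
    thus ?thesis by (auto simp: mem_sub_iff)
  next
    case True
    hence fv: "fv n = w @ s" and "y = ca n \<or> y = cb n \<or> y = cc n" by auto
    thus ?thesis
    proof (elim disjE)
      assume "y = ca n"
      hence "y \<in> C (Suc n) (w @ (s @ [False]))" using fired_children(1)[OF n] fv by simp
      thus ?thesis unfolding mem_sub_iff by blast
    next
      assume "y = cc n"
      hence "y \<in> C (Suc n) (w @ (s @ [True]))" using fired_children(2)[OF n] fv by simp
      thus ?thesis unfolding mem_sub_iff by blast
    next
      assume y: "y = cb n"
      show ?thesis
      proof (cases s rule: rev_cases)
        case Nil
        thus ?thesis using fv y by simp
      next
        case (snoc s' d)
        hence "parent (fv n) = w @ s'" using fv by (simp flip: append_assoc)
        hence "y \<in> C (Suc n) (w @ s')" using fired_children(3)[OF n] y by simp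
        thus ?thesis unfolding mem_sub_iff by blast
      qed
    qed
  qed
qed

text \<open>When a small chip leaves as the middle chip of a fire, an even smaller one stays behind
  in the left child.\<close>

lemma sub_small_step:
  assumes n: "n < T" and "y \<in> sub n w" "y \<le> r"
  shows "\<exists>y'\<in>sub (Suc n) w. y' \<le> r"
proof (cases "y \<in> sub (Suc n) w")
  case True
  thus ?thesis using assms by blast
next
  case False
  hence "fv n = w" "y = cb n" using sub_step[OF n] assms by auto
  moreover from this have "ca n \<in> sub (Suc n) w"
    using fired_children(1)[OF n] unfolding mem_sub_iff by blast
  ultimately show ?thesis using ca_less[OF n] assms(3) by (meson le_trans less_imp_le)
qed

lemma sub_entered:
  "n \<le> T \<Longrightarrow> x \<in> sub n (u @ [True]) \<Longrightarrow> \<exists>i<n. fv i = u \<and> cc i = x"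
proof (induction n)
  case 0
  thus ?case by (auto simp: mem_sub_iff initial initial_config_def)
next
  case (Suc n)
  hence n: "n < T" by simp
  have IH: "\<exists>i<Suc n. fv i = u \<and> cc i = x" if "x \<in> C n (u @ [True] @ s)" for s
  proof -
    have "x \<in> sub n (u @ [True])" using that unfolding mem_sub_iff by auto
    thus ?thesis using Suc.IH n by (meson less_imp_le less_SucI)
  qed
  from Suc.prems obtain s where s: "x \<in> C (Suc n) (u @ True # s)" by (auto simp: mem_sub_iff)
  hence "x \<in> C n (u @ True # s) \<or> u @ True # s = left_child (fv n) \<and> x = ca n
     \<or> u @ True # s = parent (fv n) \<and> x = cb n \<or> u @ True # s = right_child (fv n) \<and> x = cc n"
    using step[OF n] by (auto simp: mem_fire_iff)
  thus ?case
  proof (elim disjE conjE)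
    assume "x \<in> C n (u @ True # s)"
    thus ?thesis using IH[of s] by simp
  next
    assume e: "u @ True # s = left_child (fv n)" "x = ca n"
    show ?thesis
    proof (cases s rule: rev_cases)
      case Nil
      thus ?thesis using e by (simp add: left_child_def)
    next
      case (snoc s' d)
      hence "fv n = u @ [True] @ s'" using e(1) by (auto simp: left_child_def)
      thus ?thesis using IH[of s'] ca_in[OF n] e(2) by simp
    qed
  next
    assume e: "u @ True # s = parent (fv n)" "x = cb n"
    then obtain d where "fv n = u @ [True] @ (s @ [d])"
      by (cases "fv n" rule: rev_cases) auto
    thus ?thesis using IH[of "s @ [d]"] cb_in[OF n] e(2) by simp
  next
    assume e: "u @ True # s = right_child (fv n)" "x = cc n"
    show ?thesis
    proof (cases s rule: rev_cases)
      case Nil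
      thus ?thesis using e by (auto simp: right_child_def)
    next
      case (snoc s' d)
      hence "fv n = u @ [True] @ s'" using e(1) by (auto simp: right_child_def)
      thus ?thesis using IH[of s'] cc_in[OF n] e(2) by simp
    qed
  qed
qed

text \<open>One of the two chips must already lie in the left subtree: if \<open>q\<close> then
  fires the other one away, the chip it sends to the left is at most as large and restores the
  pair.\<close>

definition two_small :: "nat \<Rightarrow> vertex \<Rightarrow> nat \<Rightarrow> bool" where
  "two_small r q n \<longleftrightarrow> (\<exists>y \<in> sub n (q @ [False]). y \<le> r) \<and>
     (\<exists>y z. y \<noteq> z \<and> y \<le> r \<and> z \<le> r \<and> {y, z} \<subseteq> sub n (q @ [False]) \<union> C n q)"

lemma two_smallI:
  "x \<in> sub n (q @ [False]) \<Longrightarrow> x \<le> r \<Longrightarrow> y \<in> sub n (q @ [False]) \<union> C n q \<Longrightarrow> y \<le> r \<Longrightarrow> y \<noteq> x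
    \<Longrightarrow> two_small r q n"
  unfolding two_small_def by blast

lemma ca_in_sub: "n < T \<Longrightarrow> ca n \<in> sub (Suc n) (fv n @ [False])"
  using fired_children(1) unfolding mem_sub_iff by (metis append_Nil2)

lemma chip_step:
  "n < T \<Longrightarrow> x \<in> C n v \<Longrightarrow> x \<in> C (Suc n) v \<or> fv n = v \<and> (x = ca n \<or> x = cb n \<or> x = cc n)"
  using step by (auto simp: mem_fire_iff)

text \<open>A chip leaving the left subtree stops at \<open>q\<close>, so only a fire of
  \<open>q\<close> with \<open>ca n \<le> r\<close> can disturb the pair; then \<open>ca n\<close>
  joins the small chip of the left subtree, from which it differs because it was at
  \<open>q\<close>.\<close>

lemma two_small_step:
  assumes n: "n < T" and ts: "two_small r q n"
  shows "two_small r q (Suc n)"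
proof -
  let ?w = "q @ [False]"
  obtain x y z where x: "x \<in> sub n ?w" "x \<le> r" and yz: "y \<noteq> z" "y \<le> r" "z \<le> r"
    and mem: "y \<in> sub n ?w \<union> C n q" "z \<in> sub n ?w \<union> C n q"
    using ts unfolding two_small_def by auto
  have move: "u \<in> sub (Suc n) ?w \<union> C (Suc n) q \<or> fv n = q \<and> u \<in> C n q \<and> ca n \<le> u"
    if "u \<in> sub n ?w \<union> C n q" for u
    using that
  proof
    assume "u \<in> sub n ?w"
    thus ?thesis using sub_step[OF n] fired_children(3)[OF n] by fastforce
  next
    assume "u \<in> C n q"
    thus ?thesis using chip_step[OF n] ca_less[OF n] cb_less[OF n] by fastforce
  qed
  show ?thesis
  proof (cases "fv n = q \<and> ca n \<le> r")
    case True
    have "x \<in> sub (Suc n) ?w" using sub_step[OF n x(1)] True by auto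
    moreover have "ca n \<in> sub (Suc n) ?w" using ca_in_sub[OF n] True by simp
    moreover have "ca n \<noteq> x" using root_notin_sub[of n "ca n" q False] ca_in[OF n] True x(1) n by auto
    moreover have "ca n \<le> r" using True by simp
    ultimately show ?thesis using two_smallI[of x "Suc n" q r "ca n"] x(2) by simp
  next
    case False
    hence "{y, z} \<subseteq> sub (Suc n) ?w \<union> C (Suc n) q"
      using move[OF mem(1)] move[OF mem(2)] yz by auto
    moreover have "\<exists>x' \<in> sub (Suc n) ?w. x' \<le> r" using sub_small_step[OF n x] .
    ultimately show ?thesis unfolding two_small_def using yz by blast
  qed
qed

lemma two_small_final: "n \<le> T \<Longrightarrow> two_small r q n \<Longrightarrow> two_small r q T"
  by (induction n rule: inc_induct) (auto intro: two_small_step)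

end

context ballot_run
begin

text \<open>
  Let \<open>r\<close> be the second smallest chip and suppose it ends in the right subtree. The fire that
  sends \<open>r\<close> to the right leaves a smaller chip in the left subtree and another one at the parent,
  which must return; from then on two chips below \<open>r\<close> never leave.
\<close>

lemma two_smallest_left:
  assumes q: "q = [] \<or> q = p @ [False]" and m: "length q + 3 \<le> m"
    and R: "2 \<le> below q (fin q)" and x: "2 \<le> below q x"
  shows "2 \<le> below (q @ [False]) x"
proof (rule ccontr)
  assume "\<not> 2 \<le> below (q @ [False]) x"
  define A where "A = {y \<in> sub T (q @ [False]). y < x}"
  define B where "B = {y \<in> sub T (q @ [True]). y < x}"
  have A: "card A \<le> 1" using \<open>\<not> 2 \<le> _\<close> by (simp add: A_def below_def)
  have B: "card B \<le> 1" using ballot[of q x] m A by (simp add: A_def B_def below_def)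
  have finA: "finite A" and finB: "finite B" using finite_sub by (simp_all add: A_def B_def)
  have split: "sub T q = insert (fin q) (sub T (q @ [False]) \<union> sub T (q @ [True]))"
    using sub_split[of T q] final_eq[of q] m by simp
  have small: "{y \<in> sub T q. y < z} \<subseteq> A \<union> {y \<in> B. y < z}" if "z \<le> x" "z \<le> fin q" for z
    using that unfolding split A_def B_def by auto
  \<comment> \<open>By \<open>R\<close> and \<open>x\<close>, whichever of \<open>x\<close> and
    \<open>fin q\<close> is smaller has two chips of the subtree below it, while \<open>A\<close>
    has at most one element.\<close>
  have not_A: False if "{y \<in> sub T q. y < min x (fin q)} \<subseteq> A"
  proof -
    have "below q (min x (fin q)) \<le> 1" using card_mono[OF finA that] A by (simp add: below_def)
    thus False using R x by (cases "x \<le> fin q") (auto simp: min_def)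
  qed
  have "\<not> B \<subseteq> {}" using small[of "min x (fin q)"] not_A by auto
  then obtain r where r: "r \<in> B" by blast
  have Br: "B = {r}" using r B finB card_le_Suc0_iff_eq[of B] by auto
  have finr: "r < fin q"
  proof (rule ccontr)
    assume "\<not> r < fin q"
    thus False using small[of "min x (fin q)"] not_A unfolding Br by auto
  qed
  have no: "\<not> two_small r q T"
  proof
    assume "two_small r q T"
    then obtain y z where yz: "y \<noteq> z" "y \<le> r" "z \<le> r" "{y, z} \<subseteq> sub T (q @ [False]) \<union> C T q"
      unfolding two_small_def by blast
    hence "{y, z} \<subseteq> A" using r finr final_eq[of q] m unfolding A_def B_def by auto
    hence "card {y, z} \<le> 1" using card_mono[OF finA] A by (meson le_trans)
    thus False using yz(1) by simp
  qed
  have "r \<in> sub T (q @ [True])" using r by (simp add: B_def)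
  then obtain n where n: "n < T" "fv n = q" "cc n = r" using sub_entered[of T r q] by auto
  have le: "ca n \<le> r" "cb n \<le> r" and ne: "ca n \<noteq> cb n"
    using ca_less[OF n(1)] cb_less[OF n(1)] n(3) by auto
  have ca: "ca n \<in> sub (Suc n) (q @ [False])" using ca_in_sub[OF n(1)] n(2) by simp
  have cb: "cb n \<in> C (Suc n) (parent q)" using fired_children(3)[OF n(1)] n(2) by simp
  show False
  proof (cases "q = []")
    case True
    hence "two_small r q (Suc n)" using two_smallI[OF ca le(1), of "cb n"] cb le ne by simp
    thus False using two_small_final[of "Suc n"] no n(1) by simp
  next
    case False
    hence qp: "q = p @ [False]" using q by simp
    obtain n' where n': "event n' p 1" using event_exists[of 1 p] m qp by auto
    have n'T: "n' < T" "fv n' = p" using eventD[OF n'] by auto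
    have less: "n < n'"
    proof (rule ccontr)
      assume "\<not> n < n'"
      hence "rem n q \<le> rem n' q" by (intro rem_antimono) simp
      also have "\<dots> = 0" using event_rem_child[OF n', of False] m qp by simp
      finally show False using rem_Suc[OF n(1), of q] n(2) by simp
    qed
    have to_q: "two_small r q (Suc i)"
      if "i < T" "fv i = p" "ca i \<le> r" "y \<in> sub i (q @ [False])" "y \<le> r" for i y
    proof -
      from sub_small_step[OF that(1,4,5)]
      obtain y' where y': "y' \<in> sub (Suc i) (q @ [False])" "y' \<le> r" by blast
      have "ca i \<in> C (Suc i) q" using fired_children(1)[OF that(1)] that(2) qp by simp
      moreover from this have "ca i \<noteq> y'"
        using root_notin_sub[of "Suc i" "ca i" q False] y' that(1) by auto
      ultimately show ?thesis using two_smallI[OF y', of "ca i"] that(3) by simp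
    qed
    \<comment> \<open>The middle chip fired by \<open>q\<close> waits at \<open>p\<close>. Any fire
      of \<open>p\<close> that removes it sends a chip no larger to \<open>q\<close>, and so does
      the last fire of \<open>p\<close>, because \<open>p\<close> then holds only the three chips it
      fires.\<close>
    define waiting where
      "waiting i \<longleftrightarrow> (\<exists>y \<in> sub i (q @ [False]). y \<le> r) \<and> (\<exists>z \<in> C i p. z \<le> r)" for i
    have "two_small r q n' \<or> waiting n'"
    proof -
      have "Suc n \<le> n'" using less by simp
      thus ?thesis
      proof (induction n' rule: dec_induct)
        case base
        show ?case using ca cb le qp unfolding waiting_def by auto
      next
        case (step i)
        have iT: "i < T" using step n'T by simp
        from step.IH show ?case
        proof
          assume "two_small r q i"
          thus ?thesis using two_small_step[OF iT] by simp
        next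
          assume "waiting i"
          then obtain y z where y: "y \<in> sub i (q @ [False])" "y \<le> r" and z: "z \<in> C i p" "z \<le> r"
            unfolding waiting_def by blast
          show ?thesis
          proof (cases "z \<in> C (Suc i) p")
            case True
            thus ?thesis using z sub_small_step[OF iT y] unfolding waiting_def by blast
          next
            case False
            hence "fv i = p" "ca i \<le> z"
              using chip_step[OF iT z(1)] ca_less[OF iT] cb_less[OF iT] by auto
            thus ?thesis using to_q[OF iT _ _ y] z(2) by simp
          qed
        qed
      qed
    qed
    hence "two_small r q (Suc n')"
    proof
      assume "two_small r q n'"
      thus ?thesis using two_small_step n'T by simp
    next
      assume "waiting n'"
      then obtain y z where y: "y \<in> sub n' (q @ [False])" "y \<le> r" and z: "z \<in> C n' p" "z \<le> r"
        unfolding waiting_def by blast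
      have "ca n' \<le> z" using chip_bounds(1)[OF n' _ z(1)] m qp by simp
      thus ?thesis using to_q[OF n'T _ y] z(2) by simp
    qed
    thus False using two_small_final[of "Suc n'"] no n'T by simp
  qed
qed

text \<open>At the root and at right children the final chip exceeds the chip sent to the left in
  the last fire of \<open>v\<close>, and \<open>R\<close> at the left child supplies the rest. At a
  left child \<open>below_traced\<close> applies; its transfer needs the claim at the shallower
  vertices of the path, hence the induction on depth.\<close>

lemma below_fin_Suc:
  assumes R: "\<And>v. length v + Suc j \<le> m \<Longrightarrow> j \<le> below v (fin v)"
    and transfer: "\<And>p x. length p + j + 3 \<le> m \<Longrightarrow> Suc j \<le> below (p @ [False]) (fin (p @ [False]))
      \<Longrightarrow> Suc j \<le> below (p @ [False]) x \<Longrightarrow> Suc j \<le> below ((p @ [False]) @ [False]) x"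
  shows "length v + Suc (Suc j) \<le> m \<Longrightarrow> Suc j \<le> below v (fin v)"
proof (induction "length v" arbitrary: v rule: less_induct)
  case less
  note m = \<open>length v + Suc (Suc j) \<le> m\<close>
  have deep: "Suc j \<le> below v x" if "event n v 1" "ca n < x" for n x
    using below_leftmost_ge[OF R that(1) _ that(2)] m below_append_le[of v "[False]" x] by simp
  show ?case
  proof (cases v rule: rev_cases)
    case Nil
    obtain n where n: "event n [] 1" using event_exists[of 1 "[]"] m by auto
    have "ca n < fin []" using fin_root[OF n] m ca_less[of n] eventD[OF n] by simp
    thus ?thesis using deep n Nil by simp
  next
    case (snoc u e)
    obtain n where n: "event n u 1" using event_exists[of 1 u] m snoc by auto
    show ?thesis
    proof (cases e)
      case True
      obtain n' where n': "event n' v 1" using event_exists[of 1 v] m by auto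
      have "cb n' \<in> C n u" using cb_arrives(2)[of n' u e 1 n] n n' m snoc by simp
      hence "cb n' \<le> cc n" using chip_bounds(2)[OF n] m snoc by simp
      hence "ca n' < fin v" using fin_right[OF n] m snoc True ca_less[of n'] eventD[OF n'] by simp
      thus ?thesis using deep[OF n'] by simp
    next
      case False
      have "Suc j \<le> below v (ca n)"
      proof (rule below_traced[OF R _ m n])
        show "v = u @ replicate 1 False" using snoc False by simp
        fix i x
        assume i: "0 < i" "i < length v" and b: "Suc j \<le> below (take i v) x"
          and t: "take (Suc i) v = take i v @ [False]" "last (take i v) = False"
        define p where "p = butlast (take i v)"
        have ne: "take i v \<noteq> []" using i by auto
        have p: "take i v = p @ [False]" using append_butlast_last_id[OF ne] t(2) by (simp add: p_def)
        have len: "length p + 1 = i"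
          using arg_cong[OF p, of length] i by simp
        have "Suc j \<le> below (take i v) (fin (take i v))"
          using less.hyps[of "take i v"] i m by simp
        thus "Suc j \<le> below (take (Suc i) v) x"
          using transfer[of p x] b t(1) p len i m by simp
      qed
      thus ?thesis using fin_left[OF n] m snoc False by simp
    qed
  qed
qed

text \<open>For a single chip the transfer is the ballot condition: a chip below both
  \<open>x\<close> and the final chip lies in one of the two child subtrees.\<close>

lemma below_fin_1: "length v + 2 \<le> m \<Longrightarrow> 1 \<le> below v (fin v)"
proof -
  have "Suc 0 \<le> below v (fin v)" if "length v + Suc (Suc 0) \<le> m"
    using _ _ that
  proof (rule below_fin_Suc)
    fix p x
    let ?q = "p @ [False]"
    assume m: "length p + 0 + 3 \<le> m" and f: "Suc 0 \<le> below ?q (fin ?q)" and x: "Suc 0 \<le> below ?q x"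
    have "\<exists>y \<in> sub T ?q. y < z" if "Suc 0 \<le> below ?q z" for z
    proof (rule ccontr)
      assume "\<not> ?thesis"
      hence "{y \<in> sub T ?q. y < z} = {}" by blast
      hence "below ?q z = 0" unfolding below_def by (simp only: card.empty)
      thus False using that by simp
    qed
    then obtain y where y: "y \<in> sub T ?q" "y < x" "y < fin ?q"
      using f x by (metis less_trans linorder_less_linear)
    have "y \<in> sub T (?q @ [False]) \<or> y \<in> sub T (?q @ [True])"
      using y(1,3) sub_split[of T ?q] final_eq[of ?q] m by auto
    hence "0 < below (?q @ [False]) x \<or> 0 < below (?q @ [True]) x"
      using y(2) finite_sub unfolding below_def by (auto simp: card_gt_0_iff)
    thus "Suc 0 \<le> below (?q @ [False]) x" using ballot[of ?q x] m by auto
  qed simp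
  thus "length v + 2 \<le> m \<Longrightarrow> 1 \<le> below v (fin v)" by simp
qed

lemma below_fin_2: "length v + 3 \<le> m \<Longrightarrow> 2 \<le> below v (fin v)"
proof -
  have "Suc 1 \<le> below v (fin v)" if "length v + Suc (Suc 1) \<le> m"
    using _ _ that
  proof (rule below_fin_Suc)
    show "1 \<le> below v (fin v)" if "length v + Suc 1 \<le> m" for v
      using below_fin_1 that by simp
    fix p x
    assume "length p + 1 + 3 \<le> m" "Suc 1 \<le> below (p @ [False]) (fin (p @ [False]))"
      "Suc 1 \<le> below (p @ [False]) x"
    thus "Suc 1 \<le> below ((p @ [False]) @ [False]) x"
      using two_smallest_left[of "p @ [False]" p x] by simp
  qed
  thus "length v + 3 \<le> m \<Longrightarrow> 2 \<le> below v (fin v)" by simp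
qed

end

section \<open>Stable configurations under the ballot hypothesis\<close>

text \<open>Turns a comparison of \<open>i\<close>-th smallest elements into a comparison of
  threshold counts, the form in which the ballot hypothesis is used.\<close>

lemma sorted_nth_less_iff:
  fixes A :: "nat set"
  assumes "finite A" "i < card A"
  shows "sorted_list_of_set A ! i < x \<longleftrightarrow> i < card {y \<in> A. y < x}"
proof -
  define L where "L = sorted_list_of_set A"
  have len: "length L = card A" and set: "set L = A" and dist: "distinct L"
    and L: "sorted_wrt (<) L"
    using assms by (simp_all add: L_def)
  have mono: "a \<le> b \<Longrightarrow> b < length L \<Longrightarrow> L ! a \<le> L ! b" for a b
    using sorted_wrt_nth_less[OF L, of a b] by (cases "a = b") auto
  have inj: "inj_on ((!) L) {..<length L}"
    using dist by (auto simp: inj_on_def nth_eq_iff_index_eq)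
  have "i < card {y \<in> A. y < x}" if "L ! i < x"
  proof -
    have "(!) L ` {..i} \<subseteq> {y \<in> A. y < x}"
    proof
      fix y assume "y \<in> (!) L ` {..i}"
      then obtain k where k: "k \<le> i" "y = L ! k" by auto
      hence "y \<in> set L" using assms(2) len by simp
      moreover have "y < x" using mono[of k i] k that assms(2) len by simp
      ultimately show "y \<in> {y \<in> A. y < x}" using set by simp
    qed
    moreover have "{..i} \<subseteq> {..<length L}" using assms(2) len by auto
    hence "card ((!) L ` {..i}) = Suc i" using card_image[OF inj_on_subset[OF inj]] by simp
    ultimately show ?thesis using card_mono[of "{y \<in> A. y < x}" "(!) L ` {..i}"] assms(1) by simp
  qed
  moreover have "\<not> i < card {y \<in> A. y < x}" if "\<not> L ! i < x"
  proof -
    have "{y \<in> A. y < x} \<subseteq> (!) L ` {..<i}"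
    proof
      fix y assume y: "y \<in> {y \<in> A. y < x}"
      then obtain k where k: "k < length L" "y = L ! k" using set by (auto simp: in_set_conv_nth)
      hence "k < i" using mono[of i k] y that by (metis le_less_trans mem_Collect_eq not_less)
      thus "y \<in> (!) L ` {..<i}" using k by simp
    qed
    hence "card {y \<in> A. y < x} \<le> card ((!) L ` {..<i})" by (intro card_mono) auto
    also have "\<dots> \<le> i" using card_image_le[of "{..<i}" "(!) L"] by simp
    finally show ?thesis by simp
  qed
  ultimately show ?thesis by (auto simp: L_def)
qed

lemma card_short: "card {w :: vertex. length w < d} = 2 ^ d - 1"
proof (induction d)
  case 0
  show ?case by simp
next
  case (Suc d)
  have "{w :: vertex. length w < Suc d} = {w. length w < d} \<union> {w. set w \<subseteq> UNIV \<and> length w = d}"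
    by auto
  moreover have "card {w :: vertex. set w \<subseteq> UNIV \<and> length w = d} = 2 ^ d"
    using card_lists_length_eq[of "UNIV :: bool set" d] by simp
  moreover have "finite {w :: vertex. set w \<subseteq> UNIV \<and> length w = d}"
    by (rule finite_lists_length_eq) simp
  moreover have "finite {w :: vertex. length w < d}"
    using finite_lists_length_le[of "UNIV :: bool set" d] by (rule finite_subset[rotated]) auto
  ultimately have "card {w :: vertex. length w < Suc d} = (2 ^ d - 1) + 2 ^ d"
    using Suc by (subst \<open>{w :: vertex. length w < Suc d} = _\<close>, subst card_Un_disjoint) auto
  thus ?case by simp
qed

definition chip :: "config \<Rightarrow> vertex \<Rightarrow> nat" where
  "chip K v = the_elem (K v)"

definition smaller :: "config \<Rightarrow> vertex \<Rightarrow> nat \<Rightarrow> nat" where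
  "smaller K v x = card {y \<in> subtree_chips K v. y < x}"

definition larger :: "config \<Rightarrow> vertex \<Rightarrow> nat \<Rightarrow> nat" where
  "larger K v x = card {y \<in> subtree_chips K v. x < y}"

lemma config_on_fires: "config_on N K \<Longrightarrow> fires K K' \<Longrightarrow> config_on N K'"
  by (erule fires.cases) (auto intro: config_on_fire)

lemma config_on_reachable: "fires\<^sup>*\<^sup>* (initial_config N) K \<Longrightarrow> config_on N K"
  by (induction rule: rtranclp_induct) (auto intro: config_on_initial config_on_fires)

locale stable_config =
  fixes m :: nat and K :: config
  assumes stable: "K \<in> stable_configs (2 ^ m - 1)" and m_pos: "0 < m"
begin

lemma config_on: "config_on (2 ^ m - 1) K"
  using stable config_on_reachable by (auto simp: stable_configs_def)

lemma config_eq: "K v = (if length v < m then {chip K v} else {})"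
proof -
  obtain T C fv ca cb cc where run: "chip_run m T C fv ca cb cc" "C T = K"
    using stable_configs_run[OF stable m_pos] .
  show ?thesis
    using chip_run.final_eq[OF run(1), of v] unfolding chip_run.fin_def[OF run(1)] run(2) chip_def .
qed

lemma inj_on_chip: "inj_on (chip K) {v. length v < m}"
proof (rule inj_onI)
  fix v w assume "v \<in> {v. length v < m}" "w \<in> {v. length v < m}" "chip K v = chip K w"
  thus "v = w" using config_on_disjoint[OF config_on, of "chip K v" v w] config_eq by simp
qed

lemma subtree_chips_eq: "subtree_chips K v = (\<lambda>w. chip K (v @ w)) ` {w. length w < m - length v}"
proof (rule set_eqI)
  fix x
  have "x \<in> subtree_chips K v \<longleftrightarrow> (\<exists>w. length (v @ w) < m \<and> x = chip K (v @ w))"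
    unfolding subtree_chips_def using config_eq by auto
  thus "x \<in> subtree_chips K v \<longleftrightarrow> x \<in> (\<lambda>w. chip K (v @ w)) ` {w. length w < m - length v}"
    by (auto simp: less_diff_conv add.commute)
qed

lemma finite_subtree_chips: "finite (subtree_chips K v)"
  unfolding subtree_chips_eq by (rule finite_imageI)
    (use finite_lists_length_le[of "UNIV :: bool set" "m - length v"] in
      \<open>rule finite_subset[rotated], auto\<close>)

lemma card_subtree_chips: "card (subtree_chips K v) = 2 ^ (m - length v) - 1"
proof -
  have "inj_on (\<lambda>w. chip K (v @ w)) {w. length w < m - length v}"
  proof (rule inj_onI)
    fix w w' assume "w \<in> {w. length w < m - length v}" "w' \<in> {w. length w < m - length v}"
      "chip K (v @ w) = chip K (v @ w')"
    thus "w = w'" using inj_onD[OF inj_on_chip, of "v @ w" "v @ w'"] by simp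
  qed
  thus ?thesis unfolding subtree_chips_eq by (simp add: card_image card_short)
qed

lemma subtree_chips_range: "x \<in> subtree_chips K v \<Longrightarrow> 1 \<le> x \<and> x \<le> 2 ^ m - 1"
  using config_on_range[OF config_on] by (auto simp: subtree_chips_def)

lemma chip_in_subtree: "length (v @ w) < m \<Longrightarrow> chip K (v @ w) \<in> subtree_chips K v"
  unfolding subtree_chips_eq by auto

lemma subtree_chips_disjoint:
  assumes "x \<in> subtree_chips K (v @ [False])" "x \<in> subtree_chips K (v @ [True])"
  shows False
proof -
  obtain w w' where "x \<in> K (v @ [False] @ w)" "x \<in> K (v @ [True] @ w')"
    using assms by (auto simp: subtree_chips_def)
  from config_on_disjoint[OF config_on this] show False by simp
qed

lemma chip_notin_child_subtree:
  assumes "length v < m"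
  shows "chip K v \<notin> subtree_chips K (v @ [d])"
proof
  assume "chip K v \<in> subtree_chips K (v @ [d])"
  then obtain w where "chip K v \<in> K (v @ [d] @ w)" by (auto simp: subtree_chips_def)
  moreover have "chip K v \<in> K v" using config_eq[of v] assms by simp
  ultimately have "v = v @ [d] @ w" using config_on_disjoint[OF config_on] by blast
  thus False by simp
qed

lemma subtree_chips_split:
  assumes "length v < m"
  shows "subtree_chips K v = insert (chip K v) (subtree_chips K (v @ [False]) \<union> subtree_chips K (v @ [True]))"
proof -
  have "x \<in> subtree_chips K v \<longleftrightarrow> x \<in> K v \<or> x \<in> subtree_chips K (v @ [False]) \<or> x \<in> subtree_chips K (v @ [True])" for x
  proof -
    have "(\<exists>w. x \<in> K (v @ w)) \<longleftrightarrow> x \<in> K v \<or> (\<exists>w. x \<in> K (v @ False # w)) \<or> (\<exists>w. x \<in> K (v @ True # w))"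
      by (metis (full_types) append_Nil2 neq_Nil_conv)
    thus ?thesis by (simp add: subtree_chips_def)
  qed
  thus ?thesis using config_eq[of v] assms by auto
qed

end

locale ballot_config = stable_config +
  assumes hypothesis: ballot_hypothesis
begin

text \<open>If the right subtree has \<open>i + 1\<close> chips below \<open>x\<close>, its entry at
  index \<open>i\<close> is below \<open>x\<close>, and so is the smaller entry of the left
  subtree.\<close>

lemma smaller_right_le:
  assumes "length v + 1 < m"
  shows "smaller K (v @ [True]) x \<le> smaller K (v @ [False]) x"
proof (cases "smaller K (v @ [True]) x")
  case 0
  thus ?thesis by simp
next
  case (Suc i)
  let ?A = "subtree_chips K (v @ [False])" and ?B = "subtree_chips K (v @ [True])"
  have c: "card ?A = card ?B" by (simp add: card_subtree_chips)
  have i: "i < card ?B"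
    using Suc card_mono[of ?B "{y \<in> ?B. y < x}"] finite_subtree_chips by (force simp: smaller_def)
  have "m \<ge> 1" "K \<in> stable_configs (2 ^ m - 1)" "1 \<le> layer v \<and> layer v \<le> m - 1"
    using m_pos stable assms by (auto simp: layer_def)
  hence "sorted_list_of_set ?A ! i < sorted_list_of_set ?B ! i"
    using hypothesis i c unfolding ballot_hypothesis_def Let_def left_child_def right_child_def by metis
  moreover have "sorted_list_of_set ?B ! i < x"
    using sorted_nth_less_iff[of ?B i x] i Suc finite_subtree_chips by (simp add: smaller_def)
  ultimately have "sorted_list_of_set ?A ! i < x" by simp
  thus ?thesis
    using sorted_nth_less_iff[of ?A i x] i c Suc finite_subtree_chips by (simp add: smaller_def)
qed

lemma
  shows smaller_chip_1: "length v + 2 \<le> m \<Longrightarrow> 1 \<le> smaller K v (chip K v)"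
    and smaller_chip_2: "length v + 3 \<le> m \<Longrightarrow> 2 \<le> smaller K v (chip K v)"
    and smaller_left_2: "v = [] \<or> v = p @ [False] \<Longrightarrow> length v + 3 \<le> m \<Longrightarrow> 2 \<le> smaller K v x
      \<Longrightarrow> 2 \<le> smaller K (v @ [False]) x"
    and chip_less_right: "v = p @ [False] \<Longrightarrow> length v + 2 \<le> m \<Longrightarrow> chip K v < chip K (v @ [True])"
    and chip_left_less_root: "2 \<le> m \<Longrightarrow> chip K [False] < chip K []"
proof -
  obtain T C fv ca cb cc where run: "chip_run m T C fv ca cb cc" and K: "C T = K"
    using stable_configs_run[OF stable m_pos] .
  have below: "chip_run.below T C u x = smaller K u x" for u x
    by (simp add: chip_run.below_def[OF run] chip_run.sub_def[OF run] smaller_def K)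
  have fin: "chip_run.fin T C u = chip K u" for u
    by (simp add: chip_run.fin_def[OF run] chip_def K)
  have br: "ballot_run m T C fv ca cb cc"
    unfolding ballot_run_def ballot_run_axioms_def using run smaller_right_le by (simp add: below)
  note b1 = ballot_run.below_fin_1[OF br, unfolded below fin]
  note b2 = ballot_run.below_fin_2[OF br, unfolded below fin]
  note b3 = ballot_run.two_smallest_left[OF br, unfolded below fin]
  show "length v + 2 \<le> m \<Longrightarrow> 1 \<le> smaller K v (chip K v)" by (rule b1)
  show "length v + 3 \<le> m \<Longrightarrow> 2 \<le> smaller K v (chip K v)" by (rule b2)
  show "v = [] \<or> v = p @ [False] \<Longrightarrow> length v + 3 \<le> m \<Longrightarrow> 2 \<le> smaller K v x
      \<Longrightarrow> 2 \<le> smaller K (v @ [False]) x"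
    using b3[of v p x] b2[of v] by simp
  show "v = p @ [False] \<Longrightarrow> length v + 2 \<le> m \<Longrightarrow> chip K v < chip K (v @ [True])"
    using chip_run.fin_less_fin_right[OF run, of v p] by (simp add: fin)
  show "2 \<le> m \<Longrightarrow> chip K [False] < chip K []"
    using chip_run.fin_left_less_fin_root[OF run] by (simp add: fin)
qed

text \<open>The root chip exceeds the chip of the left child, which already has two smaller chips in
  its own subtree.\<close>

lemma smaller_root_3:
  assumes "4 \<le> m"
  shows "3 \<le> smaller K [] (chip K [])"
proof -
  let ?A = "{y \<in> subtree_chips K [False]. y < chip K [False]}"
  have l: "chip K [False] < chip K []" using chip_left_less_root assms by simp
  have "2 \<le> card ?A" using smaller_chip_2[of "[False]"] assms by (simp add: smaller_def)
  hence "3 \<le> card (insert (chip K [False]) ?A)" using finite_subtree_chips by simp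
  also have "\<dots> \<le> smaller K [] (chip K [])"
    unfolding smaller_def
    using l finite_subtree_chips subtree_chips_split[of "[]"] chip_in_subtree[of "[False]" "[]"] assms
    by (intro card_mono) auto
  finally show ?thesis .
qed

end

section \<open>Reflection\<close>

definition mirror :: "nat \<Rightarrow> config \<Rightarrow> config" where
  "mirror N K v = (\<lambda>x. Suc N - x) ` K (map Not v)"

lemma Not_comp_Not [simp]: "Not \<circ> Not = id"
  by auto

lemma map_Not_Not: "map Not (map Not v) = v"
  by simp

lemma map_Not_eq_iff: "map Not v = w \<longleftrightarrow> v = map Not w"
  by auto

text \<open>Reversing the labels swaps the roles of \<open>a\<close> and \<open>c\<close>, which
  matches the exchange of the children. Truncated subtraction is injective only on labels up to
  \<open>N\<close>, hence \<open>config_on\<close>.\<close>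

lemma fires_mirror:
  assumes K: "config_on N K" and "fires K K'"
  shows "fires (mirror N K) (mirror N K')"
  using assms(2)
proof cases
  case (1 a v b c)
  let ?f = "\<lambda>x. Suc N - x"
  have r: "a \<le> N" "b \<le> N" "c \<le> N" using 1 config_on_range[OF K] by auto
  have inj: "inj_on ?f {..N}" by (auto simp: inj_on_def)
  have Kv: "K v \<subseteq> {..N}" using config_on_range[OF K] by auto
  have diff: "?f ` (K v - {a, b, c}) = ?f ` K v - {?f a, ?f b, ?f c}"
    using inj_on_image_set_diff[OF inj, of "K v" "{a, b, c}"] Kv r by auto
  have par: "map Not (parent v) = parent (map Not v)" by (simp add: parent_def map_butlast)
  have "mirror N K' = fire (map Not v) (?f c) (?f b) (?f a) (mirror N K)"
  proof
    fix w
    have e: "map Not w = v \<longleftrightarrow> w = map Not v" "map Not w = left_child v \<longleftrightarrow> w = right_child (map Not v)"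
      "map Not w = right_child v \<longleftrightarrow> w = left_child (map Not v)" "map Not w = parent v \<longleftrightarrow> w = parent (map Not v)"
      by (simp_all add: map_Not_eq_iff par left_child_def right_child_def)
    show "mirror N K' w = fire (map Not v) (?f c) (?f b) (?f a) (mirror N K) w"
      unfolding 1(1) fire_def mirror_def image_Un e
      using diff by (auto split: if_splits)
  qed
  moreover have "fires (mirror N K) (fire (map Not v) (?f c) (?f b) (?f a) (mirror N K))"
    by (rule fires.intros) (use 1 r in \<open>auto simp: mirror_def\<close>)
  ultimately show ?thesis by simp
qed

lemma mirror_initial: "mirror N (initial_config N) = initial_config N"
proof
  fix v
  have "(\<lambda>x. Suc N - x) ` {1..N} = {1..N}"
  proof
    show "{1..N} \<subseteq> (\<lambda>x. Suc N - x) ` {1..N}"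
    proof
      fix x assume "x \<in> {1..N}"
      thus "x \<in> (\<lambda>x. Suc N - x) ` {1..N}" by (intro image_eqI[of _ _ "Suc N - x"]) auto
    qed
  qed auto
  thus "mirror N (initial_config N) v = initial_config N v"
    by (simp add: mirror_def initial_config_def)
qed

lemma mirror_stable_configs:
  assumes "K \<in> stable_configs N"
  shows "mirror N K \<in> stable_configs N"
proof -
  have "fires\<^sup>*\<^sup>* (initial_config N) K" and st: "stable K"
    using assms by (auto simp: stable_configs_def)
  from this(1) have "fires\<^sup>*\<^sup>* (initial_config N) (mirror N K)"
  proof (induction rule: rtranclp_induct)
    case base
    show ?case by (simp add: mirror_initial)
  next
    case (step K K')
    have "fires (mirror N K) (mirror N K')"
      using fires_mirror[OF config_on_reachable] step by blast
    thus ?case using step.IH by simp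
  qed
  moreover have "stable (mirror N K)"
    unfolding stable_def
  proof
    fix v
    have "finite (K (map Not v))"
      using config_on_finite[OF config_on_reachable] assms by (auto simp: stable_configs_def)
    hence "card (mirror N K v) \<le> card (K (map Not v))" by (simp add: mirror_def card_image_le)
    also have "\<dots> < 3" using st by (simp add: stable_def)
    finally show "card (mirror N K v) < 3" .
  qed
  ultimately show ?thesis by (simp add: stable_configs_def)
qed

context ballot_config
begin

definition mirrored :: config where
  "mirrored = mirror (2 ^ m - 1) K"

lemma mirrored_ballot_config: "ballot_config m mirrored"
  unfolding mirrored_def using mirror_stable_configs[OF stable] m_pos hypothesis by unfold_locales

lemma chip_mirror: "length v < m \<Longrightarrow> chip mirrored v = 2 ^ m - chip K (map Not v)"
proof -
  assume "length v < m"
  hence "K (map Not v) = {chip K (map Not v)}" using config_eq[of "map Not v"] by simp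
  hence "mirrored v = {2 ^ m - chip K (map Not v)}" unfolding mirrored_def mirror_def by auto
  thus ?thesis by (simp add: chip_def)
qed

lemma subtree_mirror: "subtree_chips mirrored v = (\<lambda>x. 2 ^ m - x) ` subtree_chips K (map Not v)"
proof -
  have "(\<Union>w. K (map Not v @ map Not w)) = (\<Union>w. K (map Not v @ w))"
  proof (rule set_eqI)
    fix x
    have "x \<in> K (map Not v @ map Not (map Not w))" if "x \<in> K (map Not v @ w)" for w
      using that by (simp only: map_Not_Not)
    thus "x \<in> (\<Union>w. K (map Not v @ map Not w)) \<longleftrightarrow> x \<in> (\<Union>w. K (map Not v @ w))" by blast
  qed
  moreover have "subtree_chips mirrored v = (\<lambda>x. 2 ^ m - x) ` (\<Union>w. K (map Not v @ map Not w))"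
    unfolding subtree_chips_def mirrored_def mirror_def by (simp add: image_UN)
  ultimately show ?thesis by (simp add: subtree_chips_def)
qed

lemma smaller_mirror: "smaller mirrored v (2 ^ m - x) = larger K (map Not v) x"
proof -
  let ?B = "{y \<in> subtree_chips K (map Not v). x < y}"
  have "{y \<in> subtree_chips mirrored v. y < 2 ^ m - x} = (\<lambda>x. 2 ^ m - x) ` ?B"
    unfolding subtree_mirror using subtree_chips_range[of _ "map Not v"] by force
  moreover have "inj_on (\<lambda>x. 2 ^ m - x) ?B"
    using subtree_chips_range[of _ "map Not v"] by (force simp: inj_on_def)
  ultimately show ?thesis unfolding smaller_def larger_def by (simp add: card_image)
qed

lemma larger_chip_1: "length v + 2 \<le> m \<Longrightarrow> 1 \<le> larger K v (chip K v)"
  using ballot_config.smaller_chip_1[OF mirrored_ballot_config, of "map Not v"]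
  by (simp add: chip_mirror smaller_mirror)

lemma larger_chip_2: "length v + 3 \<le> m \<Longrightarrow> 2 \<le> larger K v (chip K v)"
  using ballot_config.smaller_chip_2[OF mirrored_ballot_config, of "map Not v"]
  by (simp add: chip_mirror smaller_mirror)

lemma larger_root_3: "4 \<le> m \<Longrightarrow> 3 \<le> larger K [] (chip K [])"
  using ballot_config.smaller_root_3[OF mirrored_ballot_config] m_pos
  by (simp add: chip_mirror smaller_mirror)

lemma larger_right_2:
  "v = [] \<or> v = p @ [True] \<Longrightarrow> length v + 3 \<le> m \<Longrightarrow> 2 \<le> larger K v x \<Longrightarrow> 2 \<le> larger K (v @ [True]) x"
  using ballot_config.smaller_left_2[OF mirrored_ballot_config, of "map Not v" "map Not p" "2 ^ m - x"]
  by (auto simp: smaller_mirror)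

lemma chip_left_less: "v = p @ [True] \<Longrightarrow> length v + 2 \<le> m \<Longrightarrow> chip K (v @ [False]) < chip K v"
  using ballot_config.chip_less_right[OF mirrored_ballot_config, of "map Not v" "map Not p"]
  by (auto simp: chip_mirror)

end

section \<open>Counting ballot words\<close>

lemma binom_Suc: "binom (Suc n) k = binom n k + binom n (k - 1)"
proof (cases "k \<le> 0")
  case True
  thus ?thesis by (cases "k = 0") (auto simp: binom_def)
next
  case False
  then obtain j where "k = int (Suc j)" by (metis not_le pos_int_cases gr0_implies_Suc)
  thus ?thesis by (simp add: binom_def nat_add_distrib)
qed

lemma binom_of_nat: "binom n (int k) = real (n choose k)"
  by (simp add: binom_def)

lemma catalan_eq: "catalan n = binom (2 * n) (int n) - binom (2 * n) (int n - 1)"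
proof (cases n)
  case 0
  thus ?thesis by (simp add: catalan_def binom_def)
next
  case (Suc a)
  have "Suc a * (2 * n choose n) = Suc n * (2 * n choose a)"
    using Suc_times_binomial_add[of a n] Suc by (simp add: mult_2)
  hence "(real n + 1) * real (2 * n choose a) = real n * real (2 * n choose n)"
    using Suc by (metis of_nat_mult of_nat_Suc add.commute)
  hence "real (2 * n choose a) = real n * real (2 * n choose n) / (real n + 1)"
    by (simp add: field_simps)
  moreover have "int n - 1 = int a" using Suc by simp
  ultimately show ?thesis unfolding catalan_def by (simp add: binom_of_nat) (simp add: field_simps)
qed

text \<open>Lattice paths that start at height \<open>h\<close> and never go below zero, with
  \<open>True\<close> as the up step.\<close>

definition ballot_words :: "nat \<Rightarrow> nat \<Rightarrow> nat \<Rightarrow> bool list set" where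
  "ballot_words h a b = {ws. count_list ws True = a \<and> count_list ws False = b \<and>
     (\<forall>k. count_list (take k ws) False \<le> h + count_list (take k ws) True)}"

lemma length_eq_count_bool: "length ws = count_list ws True + count_list ws False"
  by (induction ws) auto

lemma finite_ballot_words: "finite (ballot_words h a b)"
  by (rule finite_subset[OF _ finite_lists_length_eq[of UNIV "a + b"]])
    (auto simp: ballot_words_def length_eq_count_bool)

lemma ballot_words_subset:
  "ballot_words h a b \<subseteq> (if a = 0 \<and> b = 0 then {[]} else {}) \<union>
     (if 0 < a then Cons True ` ballot_words (Suc h) (a - 1) b else {}) \<union>
     (if 0 < b \<and> 0 < h then Cons False ` ballot_words (h - 1) a (b - 1) else {})"
proof
  fix ws assume ws: "ws \<in> ballot_words h a b"
  hence pre: "count_list (take k ws) False \<le> h + count_list (take k ws) True" for k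
    by (simp add: ballot_words_def)
  show "ws \<in> (if a = 0 \<and> b = 0 then {[]} else {}) \<union>
     (if 0 < a then Cons True ` ballot_words (Suc h) (a - 1) b else {}) \<union>
     (if 0 < b \<and> 0 < h then Cons False ` ballot_words (h - 1) a (b - 1) else {})"
  proof (cases ws)
    case Nil
    thus ?thesis using ws by (auto simp: ballot_words_def)
  next
    case (Cons e us)
    show ?thesis
    proof (cases e)
      case True
      have "count_list (take k us) False \<le> Suc h + count_list (take k us) True" for k
        using pre[of "Suc k"] Cons True by simp
      hence "us \<in> ballot_words (Suc h) (a - 1) b" "0 < a"
        using ws Cons True by (auto simp: ballot_words_def)
      thus ?thesis using Cons True by simp
    next
      case False
      have h: "0 < h" using pre[of 1] Cons False by simp
      have "count_list (take k us) False \<le> (h - 1) + count_list (take k us) True" for k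
        using pre[of "Suc k"] Cons False h by simp
      hence "us \<in> ballot_words (h - 1) a (b - 1)" "0 < b"
        using ws Cons False by (auto simp: ballot_words_def)
      thus ?thesis using Cons False h by simp
    qed
  qed
qed

text \<open>The subtracted coefficient is the reflection count of the paths that reach
  \<open>-1\<close>. Splitting off the first step reproduces Pascal's rule for both coefficients.
  The premise says that the path ends at height at least zero; for \<open>a = 0\<close> it makes the
  subtracted coefficient vanish.\<close>

lemma card_ballot_words:
  "b \<le> h + a \<Longrightarrow>
    real (card (ballot_words h a b)) \<le> binom (a + b) (int b) - binom (a + b) (int b - int h - 1)"
proof (induction "a + b" arbitrary: h a b rule: less_induct)
  case less
  let ?A = "if 0 < a then Cons True ` ballot_words (Suc h) (a - 1) b else {}"
  let ?B = "if 0 < b \<and> 0 < h then Cons False ` ballot_words (h - 1) a (b - 1) else {}"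
  show ?case
  proof (cases "a + b")
    case 0
    hence "ballot_words h a b \<subseteq> {[]}" using ballot_words_subset[of h a b] by auto
    hence "card (ballot_words h a b) \<le> card {[] :: bool list}" by (intro card_mono) auto
    hence "card (ballot_words h a b) \<le> 1" by simp
    thus ?thesis using 0 by (simp add: binom_def)
  next
    case (Suc n)
    have "ballot_words h a b \<subseteq> ?A \<union> ?B"
      using ballot_words_subset[of h a b] Suc by (auto split: if_splits)
    hence "card (ballot_words h a b) \<le> card (?A \<union> ?B)"
      by (intro card_mono) (auto simp: finite_ballot_words)
    also have "\<dots> \<le> card ?A + card ?B" by (rule card_Un_le)
    finally have le: "real (card (ballot_words h a b)) \<le> real (card ?A) + real (card ?B)"
      by (metis of_nat_add of_nat_le_iff)
    have inj: "inj_on (Cons e) X" for e :: bool and X by (simp add: inj_on_def)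
    have A: "real (card ?A) \<le> binom n (int b) - binom n (int b - int h - 2)"
    proof (cases "0 < a")
      case True
      have "real (card (ballot_words (Suc h) (a - 1) b))
          \<le> binom (a - 1 + b) (int b) - binom (a - 1 + b) (int b - int (Suc h) - 1)"
        by (rule less.hyps) (use True less.prems in auto)
      moreover have "a - 1 + b = n" using True Suc by simp
      moreover have "int b - int (Suc h) - 1 = int b - int h - 2" by simp
      ultimately show ?thesis using True by (simp add: card_image[OF inj])
    next
      case False
      thus ?thesis using Suc less.prems by (simp add: binom_def)
    qed
    have B: "real (card ?B) \<le> binom n (int b - 1) - binom n (int b - int h - 1)"
    proof (cases "0 < b \<and> 0 < h")
      case True
      have "real (card (ballot_words (h - 1) a (b - 1)))
          \<le> binom (a + (b - 1)) (int (b - 1)) - binom (a + (b - 1)) (int (b - 1) - int (h - 1) - 1)"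
        by (rule less.hyps) (use True less.prems in auto)
      moreover have "a + (b - 1) = n" using True Suc by simp
      moreover have "int (b - 1) = int b - 1" "int (b - 1) - int (h - 1) - 1 = int b - int h - 1"
        using True by auto
      ultimately show ?thesis using True by (simp add: card_image[OF inj])
    next
      case False
      hence "b = 0 \<or> h = 0" by simp
      thus ?thesis using False by (auto simp: binom_def)
    qed
    have e: "int b - int h - 1 - 1 = int b - int h - 2" by simp
    show ?thesis using le A B unfolding Suc binom_Suc e by linarith
  qed
qed

lemma count_list_map_bool:
  assumes "distinct xs"
  shows "count_list (map P xs) True = card {y \<in> set xs. P y}"
    and "count_list (map P xs) False = card {y \<in> set xs. \<not> P y}"
proof -
  have "count_list (map P xs) True = card {y \<in> set xs. P y} \<and>
     count_list (map P xs) False = card {y \<in> set xs. \<not> P y}"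
    using assms
  proof (induction xs)
    case (Cons x xs)
    have ins: "{y \<in> set (x # xs). Q y} = (if Q x then insert x {y \<in> set xs. Q y} else {y \<in> set xs. Q y})" for Q
      by auto
    show ?case using Cons unfolding ins by auto
  qed simp
  thus "count_list (map P xs) True = card {y \<in> set xs. P y}"
    "count_list (map P xs) False = card {y \<in> set xs. \<not> P y}" by auto
qed

section \<open>Interleavings\<close>

text \<open>The letter \<open>True\<close> stands for an element of \<open>A\<close>, below always the left subtree.\<close>

definition word :: "nat set \<Rightarrow> nat set \<Rightarrow> bool list" where
  "word A B = map (\<lambda>x. x \<in> A) (sorted_list_of_set (A \<union> B))"

lemma set_take_sorted:
  fixes U :: "nat set"
  assumes "finite U"
  defines "L \<equiv> sorted_list_of_set U"
  shows "set (take (card {y \<in> U. y < x}) L) = {y \<in> U. y < x}"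
    and "set (drop (card {y \<in> U. y < x}) L) = {y \<in> U. x \<le> y}"
proof -
  define j where "j = card {y \<in> U. y < x}"
  have len: "length L = card U" and set: "set L = U" using assms by auto
  have nth: "L ! i < x \<longleftrightarrow> i < j" if "i < length L" for i
    using sorted_nth_less_iff[OF assms(1), of i x] that len by (simp add: L_def j_def)
  have mem: "y \<in> U \<longleftrightarrow> (\<exists>i < length L. y = L ! i)" for y
    unfolding set[symmetric] by (auto simp: in_set_conv_nth)
  show "set (take (card {y \<in> U. y < x}) L) = {y \<in> U. y < x}"
  proof (rule set_eqI)
    fix y
    have "y \<in> set (take j L) \<longleftrightarrow> (\<exists>i. i < j \<and> i < length L \<and> y = L ! i)"
      unfolding in_set_conv_nth by auto
    also have "\<dots> \<longleftrightarrow> y \<in> {y \<in> U. y < x}" using nth mem by auto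
    finally show "y \<in> set (take (card {y \<in> U. y < x}) L) \<longleftrightarrow> y \<in> {y \<in> U. y < x}"
      by (simp add: j_def)
  qed
  show "set (drop (card {y \<in> U. y < x}) L) = {y \<in> U. x \<le> y}"
  proof (rule set_eqI)
    fix y
    have "y \<in> set (drop j L) \<longleftrightarrow> (\<exists>i. j \<le> i \<and> i < length L \<and> y = L ! i)"
    proof
      assume "y \<in> set (drop j L)"
      then obtain i where "i < length L - j" "y = L ! (j + i)" by (auto simp: in_set_conv_nth)
      thus "\<exists>i. j \<le> i \<and> i < length L \<and> y = L ! i" by (intro exI[of _ "j + i"]) auto
    next
      assume "\<exists>i. j \<le> i \<and> i < length L \<and> y = L ! i"
      then obtain i where "j \<le> i" "i < length L" "y = L ! i" by blast
      thus "y \<in> set (drop j L)" unfolding in_set_conv_nth by (intro exI[of _ "i - j"]) auto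
    qed
    also have "\<dots> \<longleftrightarrow> y \<in> {y \<in> U. x \<le> y}" using nth mem by (auto simp: not_less[symmetric])
    finally show "y \<in> set (drop (card {y \<in> U. y < x}) L) \<longleftrightarrow> y \<in> {y \<in> U. x \<le> y}"
      by (simp add: j_def)
  qed
qed

lemma card_less_nth:
  fixes U :: "nat set"
  assumes "finite U" "k < card U"
  shows "card {y \<in> U. y < sorted_list_of_set U ! k} = k"
proof -
  define L where "L = sorted_list_of_set U"
  define j where "j = card {y \<in> U. y < L ! k}"
  have L: "sorted_wrt (<) L" "length L = card U" using assms by (simp_all add: L_def)
  have nth: "L ! i < L ! k \<longleftrightarrow> i < j" if "i < card U" for i
    using sorted_nth_less_iff[OF assms(1) that, of "L ! k"] by (simp add: L_def j_def)
  have "\<not> k < j" using nth[of k] assms by simp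
  moreover have "\<not> j < k"
  proof
    assume "j < k"
    thus False using nth[of j] sorted_wrt_nth_less[OF L(1), of j k] assms L by simp
  qed
  ultimately have "j = k" by simp
  thus ?thesis by (simp add: j_def L_def)
qed

context
  fixes A B :: "nat set"
  assumes fin: "finite A" "finite B" and disj: "A \<inter> B = {}"
begin

text \<open>The threshold need not belong to the union: the root chip of a subtree later serves to
  cut the word of its two child subtrees.\<close>

lemma count_take_word:
  "count_list (take (card {y \<in> A \<union> B. y < x}) (word A B)) True = card {y \<in> A. y < x}"
  "count_list (take (card {y \<in> A \<union> B. y < x}) (word A B)) False = card {y \<in> B. y < x}"
  "count_list (drop (card {y \<in> A \<union> B. y < x}) (word A B)) True = card {y \<in> A. x \<le> y}"
  "count_list (drop (card {y \<in> A \<union> B. y < x}) (word A B)) False = card {y \<in> B. x \<le> y}"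
proof -
  have f: "finite (A \<union> B)" using fin by simp
  have d: "distinct (take k (sorted_list_of_set (A \<union> B)))" "distinct (drop k (sorted_list_of_set (A \<union> B)))" for k
    by simp_all
  have "{y \<in> A \<union> B. y < x \<and> y \<in> A} = {y \<in> A. y < x}" "{y \<in> A \<union> B. y < x \<and> y \<notin> A} = {y \<in> B. y < x}"
    "{y \<in> A \<union> B. x \<le> y \<and> y \<in> A} = {y \<in> A. x \<le> y}" "{y \<in> A \<union> B. x \<le> y \<and> y \<notin> A} = {y \<in> B. x \<le> y}"
    using disj by auto
  thus "count_list (take (card {y \<in> A \<union> B. y < x}) (word A B)) True = card {y \<in> A. y < x}"
    "count_list (take (card {y \<in> A \<union> B. y < x}) (word A B)) False = card {y \<in> B. y < x}"
    "count_list (drop (card {y \<in> A \<union> B. y < x}) (word A B)) True = card {y \<in> A. x \<le> y}"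
    "count_list (drop (card {y \<in> A \<union> B. y < x}) (word A B)) False = card {y \<in> B. x \<le> y}"
    unfolding word_def take_map drop_map count_list_map_bool[OF d(1)] count_list_map_bool[OF d(2)]
      set_take_sorted[OF f] by (simp_all add: conj_assoc)
qed

lemma count_word: "count_list (word A B) True = card A" "count_list (word A B) False = card B"
proof -
  have "{y \<in> A \<union> B. y \<in> A} = A" "{y \<in> A \<union> B. y \<notin> A} = B" using disj by auto
  thus "count_list (word A B) True = card A" "count_list (word A B) False = card B"
    using fin by (simp_all add: word_def count_list_map_bool)
qed

lemma length_word: "length (word A B) = card A + card B"
  by (simp add: length_eq_count_bool count_word)

text \<open>Every proper prefix is the cut at a threshold, namely at the element that carries the
  next letter.\<close>

lemma word_ballot:
  assumes "card A = n" "card B = n" "\<And>x. card {y \<in> B. y < x} \<le> card {y \<in> A. y < x}"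
  shows "word A B \<in> ballot_words 0 n n"
proof -
  have "count_list (take k (word A B)) False \<le> count_list (take k (word A B)) True" for k
  proof (cases "k < card (A \<union> B)")
    case True
    have "card {y \<in> A \<union> B. y < sorted_list_of_set (A \<union> B) ! k} = k"
      using card_less_nth[of "A \<union> B" k] True fin by simp
    thus ?thesis using count_take_word(1,2)[of "sorted_list_of_set (A \<union> B) ! k"] assms(3) by simp
  next
    case False
    hence "length (word A B) \<le> k" by (simp add: word_def)
    thus ?thesis using count_word assms by simp
  qed
  thus ?thesis using count_word assms by (simp add: ballot_words_def)
qed

end

section \<open>Gluing order patterns\<close>

text \<open>The index \<open>i\<close> is a rank and starts at \<open>1\<close>, the position returned starts at \<open>0\<close>.\<close>

definition nth_pos :: "bool list \<Rightarrow> bool \<Rightarrow> nat \<Rightarrow> nat" where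
  "nth_pos ws e i = filter (\<lambda>j. ws ! j = e) [0..<length ws] ! (i - 1)"

text \<open>The position of the \<open>i\<close>-th letter of a side gives the rank within both
  child subtrees together; adding the root chip of rank \<open>r\<close> shifts the ranks from
  \<open>r\<close> on by one. In a word \<open>True\<close> means left, in a path it means right,
  hence \<open>\<not> d\<close>.\<close>

definition glue :: "nat \<Rightarrow> bool list \<Rightarrow> (vertex \<Rightarrow> nat set) \<Rightarrow> (vertex \<Rightarrow> nat set) \<Rightarrow> vertex \<Rightarrow> nat set" where
  "glue r ws P Q w = (case w of [] \<Rightarrow> {r}
     | d # u \<Rightarrow> (\<lambda>i. let k = Suc (nth_pos ws (\<not> d) i) in if k < r then k else Suc k) `
         (if d then Q u else P u))"

lemma rank_in_less: "finite S \<Longrightarrow> x \<in> S \<Longrightarrow> rank_in S x = Suc (card {y \<in> S. y < x})"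
proof -
  assume "finite S" "x \<in> S"
  moreover have "{y \<in> S. y \<le> x} = insert x {y \<in> S. y < x}" using \<open>x \<in> S\<close> by auto
  ultimately show ?thesis by (simp add: rank_in_def)
qed

lemma nth_pos_map:
  assumes "finite U" "x \<in> U" "P x = e"
  shows "rank_in U x = Suc (nth_pos (map P (sorted_list_of_set U)) e (rank_in {y \<in> U. P y = e} x))"
proof -
  define L where "L = sorted_list_of_set U"
  define j where "j = card {y \<in> U. y < x}"
  have L: "set L = U" "distinct L" "length L = card U" using assms by (simp_all add: L_def)
  obtain i where i: "i < length L" "x = L ! i" using assms(2) L(1) by (auto simp: in_set_conv_nth)
  hence ij: "i = j" using card_less_nth[OF assms(1), of i] L(3) by (simp add: L_def j_def)
  let ?Q = "\<lambda>j. map P L ! j = e"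
  have up: "[0..<length L] = [0..<j] @ j # [Suc j..<length L]"
    using i ij by (metis upt_add_eq_append upt_conv_Cons le0 less_imp_le add_0 le_add_diff_inverse)
  have "filter ?Q [0..<length L] = filter ?Q [0..<j] @ j # filter ?Q [Suc j..<length L]"
    unfolding up using i ij assms(3) by simp
  moreover have "length (filter ?Q [0..<j]) = card {y \<in> {y \<in> U. P y = e}. y < x}"
  proof -
    have "map ((!) L) [0..<j] = take j L" using i ij by (intro nth_equalityI) auto
    moreover have "filter ?Q [0..<j] = filter ((\<lambda>y. P y = e) \<circ> (!) L) [0..<j]"
      using i ij by (intro filter_cong) auto
    ultimately have "length (filter ?Q [0..<j]) = length (filter (\<lambda>y. P y = e) (take j L))"
      by (metis length_map filter_map)
    also have "\<dots> = card (set (filter (\<lambda>y. P y = e) (take j L)))"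
      using L(2) by (metis distinct_card distinct_filter distinct_take)
    also have "set (filter (\<lambda>y. P y = e) (take j L)) = {y \<in> {y \<in> U. P y = e}. y < x}"
      using set_take_sorted(1)[OF assms(1), of x] by (auto simp: L_def j_def)
    finally show ?thesis .
  qed
  ultimately have "nth_pos (map P L) e (rank_in {y \<in> U. P y = e} x) = j"
    using rank_in_less[of "{y \<in> U. P y = e}" x] assms
    by (simp add: nth_pos_def nth_append)
  thus ?thesis using rank_in_less[OF assms(1,2)] by (simp add: L_def j_def)
qed

lemma rank_in_insert:
  assumes "finite U" "z \<notin> U" "x \<in> U"
  shows "rank_in (insert z U) x =
    (if rank_in U x < rank_in (insert z U) z then rank_in U x else Suc (rank_in U x))"
proof -
  have z: "rank_in (insert z U) z = Suc (card {y \<in> U. y < z})"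
  proof -
    have "{y \<in> insert z U. y < z} = {y \<in> U. y < z}" by auto
    thus ?thesis using rank_in_less[of "insert z U" z] assms by simp
  qed
  have x: "rank_in U x = Suc (card {y \<in> U. y < x})" using rank_in_less assms by simp
  have ix: "rank_in (insert z U) x = Suc (card {y \<in> insert z U. y < x})"
    using rank_in_less[of "insert z U" x] assms by simp
  show ?thesis
  proof (cases "x < z")
    case True
    have "{y \<in> insert z U. y < x} = {y \<in> U. y < x}" using True by auto
    moreover have "card (insert x {y \<in> U. y < x}) \<le> card {y \<in> U. y < z}"
      using True assms by (intro card_mono) auto
    ultimately show ?thesis using z x ix assms by simp
  next
    case False
    hence "z < x" using assms by (metis linorder_neqE_nat)
    hence "{y \<in> insert z U. y < x} = insert z {y \<in> U. y < x}" by auto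
    moreover have "card {y \<in> U. y < z} \<le> card {y \<in> U. y < x}"
      using \<open>z < x\<close> assms by (intro card_mono) auto
    ultimately show ?thesis using z x ix assms by simp
  qed
qed

context stable_config
begin

text \<open>On this layer the top \<open>l\<close> layers exhaust the subtree, so ranks are taken
  among all its chips.\<close>

lemma order_pattern_eq:
  assumes "length v + l = m"
  shows "order_pattern l K v =
    (\<lambda>w. if length w < l then {rank_in (subtree_chips K v) (chip K (v @ w))} else {})"
proof -
  have S: "(\<Union>w \<in> {w. length w < l}. K (v @ w)) = subtree_chips K v"
  proof
    show "subtree_chips K v \<subseteq> (\<Union>w \<in> {w. length w < l}. K (v @ w))"
    proof
      fix x assume "x \<in> subtree_chips K v"
      then obtain w where w: "x \<in> K (v @ w)" by (auto simp: subtree_chips_def)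
      hence "length (v @ w) < m" using config_eq[of "v @ w"] by (auto split: if_splits)
      thus "x \<in> (\<Union>w \<in> {w. length w < l}. K (v @ w))" using w assms by auto
    qed
  qed (auto simp: subtree_chips_def)
  have "K (v @ w) = {chip K (v @ w)}" if "length w < l" for w
    using config_eq[of "v @ w"] that assms by simp
  thus ?thesis unfolding order_pattern_def Let_def S by (simp add: fun_eq_iff)
qed

lemma order_pattern_Suc:
  assumes "length v + Suc l = m"
  shows "order_pattern (Suc l) K v =
    glue (rank_in (subtree_chips K v) (chip K v))
      (word (subtree_chips K (v @ [False])) (subtree_chips K (v @ [True])))
      (order_pattern l K (v @ [False])) (order_pattern l K (v @ [True]))"
proof
  fix w
  let ?A = "subtree_chips K (v @ [False])" and ?B = "subtree_chips K (v @ [True])"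
  let ?ws = "word ?A ?B" and ?r = "rank_in (subtree_chips K v) (chip K v)"
  have vm: "length v < m" using assms by simp
  have fin: "finite (?A \<union> ?B)" using finite_subtree_chips by simp
  have notin: "chip K v \<notin> ?A \<union> ?B" using chip_notin_child_subtree[OF vm] by simp
  have split: "subtree_chips K v = insert (chip K v) (?A \<union> ?B)" using subtree_chips_split[OF vm] .
  have A: "{y \<in> ?A \<union> ?B. (y \<in> ?A) = True} = ?A" and B: "{y \<in> ?A \<union> ?B. (y \<in> ?A) = False} = ?B"
    using subtree_chips_disjoint by auto
  show "order_pattern (Suc l) K v w = glue ?r ?ws (order_pattern l K (v @ [False])) (order_pattern l K (v @ [True])) w"
  proof (cases w)
    case Nil
    thus ?thesis using order_pattern_eq[OF assms] by (simp add: glue_def)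
  next
    case (Cons d u)
    have pat: "order_pattern l K (v @ [d]) u =
        (if length u < l then {rank_in (subtree_chips K (v @ [d])) (chip K (v @ d # u))} else {})" for d
      using order_pattern_eq[of "v @ [d]" l] assms by simp
    show ?thesis
    proof (cases "length u < l")
      case False
      thus ?thesis using Cons pat order_pattern_eq[OF assms] by (simp add: glue_def)
    next
      case True
      define x where "x = chip K (v @ d # u)"
      have xin: "x \<in> subtree_chips K (v @ [d])"
        using chip_in_subtree[of "v @ [d]" u] True assms by (simp add: x_def)
      have xU: "x \<in> ?A \<union> ?B" and e: "(x \<in> ?A) = (\<not> d)"
        using xin subtree_chips_disjoint[of x v] by (cases d; auto)+
      have "rank_in (?A \<union> ?B) x = Suc (nth_pos ?ws (\<not> d) (rank_in (subtree_chips K (v @ [d])) x))"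
        using nth_pos_map[OF fin xU, of "\<lambda>y. y \<in> ?A", OF e] A B unfolding word_def by (cases d) simp_all
      moreover have "rank_in (subtree_chips K v) x =
          (if rank_in (?A \<union> ?B) x < ?r then rank_in (?A \<union> ?B) x else Suc (rank_in (?A \<union> ?B) x))"
        using rank_in_insert[OF fin notin xU] by (simp add: split)
      ultimately show ?thesis
        using Cons True pat order_pattern_eq[OF assms] by (simp add: glue_def x_def)
    qed
  qed
qed

end

section \<open>Root rank and interleaving of a subtree\<close>

text \<open>This is what \<open>glue\<close> needs besides the two child patterns, so patterns are
  bounded by the number of codes times the square of the number of smaller patterns.\<close>

definition code :: "config \<Rightarrow> vertex \<Rightarrow> nat \<times> bool list" where
  "code K v = (rank_in (subtree_chips K v) (chip K v),
     word (subtree_chips K (v @ [False])) (subtree_chips K (v @ [True])))"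

lemma count_True_short: "length xs \<le> 2 \<Longrightarrow> 2 \<le> count_list xs True \<Longrightarrow> xs = [True, True]"
  by (cases xs; cases "tl xs") (auto split: if_splits)

lemma count_False_short: "length xs \<le> 2 \<Longrightarrow> 2 \<le> count_list xs False \<Longrightarrow> xs = [False, False]"
  by (cases xs; cases "tl xs") (auto split: if_splits)

context stable_config
begin

lemma rank_eq:
  assumes "length v < m"
  shows "fst (code K v) = Suc (smaller K v (chip K v))"
    and "fst (code K v) + larger K v (chip K v) = 2 ^ (m - length v) - 1"
proof -
  let ?S = "subtree_chips K v"
  have x: "chip K v \<in> ?S" using chip_in_subtree[of v "[]"] assms by simp
  have f: "finite ?S" by (rule finite_subtree_chips)
  show "fst (code K v) = Suc (smaller K v (chip K v))"
    using rank_in_less[OF f x] by (simp add: code_def smaller_def)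
  have "card ?S = card {y \<in> ?S. y \<le> chip K v} + card {y \<in> ?S. chip K v < y}"
    using f by (subst card_Un_disjoint[symmetric]) (auto intro!: arg_cong[of _ _ card])
  thus "fst (code K v) + larger K v (chip K v) = 2 ^ (m - length v) - 1"
    by (simp add: code_def rank_in_def larger_def card_subtree_chips)
qed

lemma children_disjoint: "subtree_chips K (v @ [False]) \<inter> subtree_chips K (v @ [True]) = {}"
  using subtree_chips_disjoint by blast

lemmas count_take_code =
  count_take_word[OF finite_subtree_chips finite_subtree_chips children_disjoint]

lemma card_children:
  "card (subtree_chips K (v @ [False]) \<union> subtree_chips K (v @ [True])) = 2 * (2 ^ (m - Suc (length v)) - 1)"
  by (simp add: card_Un_disjoint finite_subtree_chips children_disjoint card_subtree_chips)

lemma length_code: "length (snd (code K v)) = 2 * (2 ^ (m - Suc (length v)) - 1)"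
  using length_word[OF finite_subtree_chips finite_subtree_chips children_disjoint]
  by (simp add: code_def card_subtree_chips)

lemma below_chip_children:
  assumes "length v < m"
  shows "card {y \<in> subtree_chips K (v @ [False]) \<union> subtree_chips K (v @ [True]). y < chip K v}
    = fst (code K v) - 1"
proof -
  have "{y \<in> subtree_chips K (v @ [False]) \<union> subtree_chips K (v @ [True]). y < chip K v}
      = {y \<in> subtree_chips K v. y < chip K v}"
    using subtree_chips_split[OF assms] by auto
  thus ?thesis using rank_eq(1)[OF assms] by (simp add: smaller_def)
qed

end

context ballot_config
begin

lemma code_ballot:
  assumes "length v + 1 < m"
  shows "snd (code K v) \<in> ballot_words 0 (2 ^ (m - Suc (length v)) - 1) (2 ^ (m - Suc (length v)) - 1)"
  unfolding code_def snd_conv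
  by (rule word_ballot[OF finite_subtree_chips finite_subtree_chips children_disjoint])
    (use smaller_right_le[OF assms] in \<open>simp_all add: card_subtree_chips smaller_def\<close>)

lemma code_prefix:
  assumes "v = [] \<or> v = p @ [False]" "length v + 3 \<le> m"
  shows "take 2 (snd (code K v)) = [True, True]"
proof (rule count_True_short)
  let ?A = "subtree_chips K (v @ [False])" and ?B = "subtree_chips K (v @ [True])"
  \<comment> \<open>The third smallest chip of the two child subtrees, so exactly two of their chips
    lie below the threshold.\<close>
  define x where "x = sorted_list_of_set (?A \<union> ?B) ! 2"
  have "(2::nat) ^ 2 \<le> 2 ^ (m - Suc (length v))" using assms(2) by (intro power_increasing) auto
  hence "2 < card (?A \<union> ?B)" using card_children[of v] by simp
  hence c: "card {y \<in> ?A \<union> ?B. y < x} = 2"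
    using card_less_nth[of "?A \<union> ?B" 2] finite_subtree_chips by (simp add: x_def)
  have "{y \<in> ?A \<union> ?B. y < x} \<subseteq> {y \<in> subtree_chips K v. y < x}"
    using subtree_chips_split[of v] assms(2) by auto
  hence "card {y \<in> ?A \<union> ?B. y < x} \<le> smaller K v x"
    unfolding smaller_def using finite_subtree_chips by (intro card_mono) auto
  hence "2 \<le> smaller K (v @ [False]) x" using smaller_left_2[OF assms] c by simp
  thus "2 \<le> count_list (take 2 (snd (code K v))) True"
    using count_take_code(1)[of v x] c by (simp add: code_def smaller_def)
qed simp

lemma code_suffix:
  assumes "v = [] \<or> v = p @ [True]" "length v + 3 \<le> m"
  shows "drop (length (snd (code K v)) - 2) (snd (code K v)) = [False, False]"
proof (rule count_False_short)
  let ?A = "subtree_chips K (v @ [False])" and ?B = "subtree_chips K (v @ [True])"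
  define N where "N = length (snd (code K v))"
  have N: "N = card (?A \<union> ?B)" by (simp add: N_def length_code card_children)
  let ?x = "sorted_list_of_set (?A \<union> ?B) ! (N - 2)"
  have "(2::nat) ^ 2 \<le> 2 ^ (m - Suc (length v))" using assms(2) by (intro power_increasing) auto
  hence N2: "2 < N" by (simp add: N_def length_code)
  have fin: "finite (?A \<union> ?B)" using finite_subtree_chips by simp
  have c: "card {y \<in> ?A \<union> ?B. y < ?x} = N - 2"
    using card_less_nth[OF fin, of "N - 2"] N2 N by simp
  have "?x \<in> set (sorted_list_of_set (?A \<union> ?B))" using N2 N by (intro nth_mem) simp
  hence "?x \<in> ?A \<union> ?B" using fin by simp
  \<comment> \<open>\<open>larger\<close> is strict while the cut counts chips from
    \<open>?x\<close> on, so the threshold is lowered by one; positivity keeps the truncated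
    subtraction harmless.\<close>
  hence x1: "1 \<le> ?x" using subtree_chips_range by blast
  have "card (?A \<union> ?B) = card {y \<in> ?A \<union> ?B. y < ?x} + card {y \<in> ?A \<union> ?B. ?x \<le> y}"
    using fin by (subst card_Un_disjoint[symmetric]) (auto intro!: arg_cong[of _ _ card])
  hence "2 = card {y \<in> ?A \<union> ?B. ?x \<le> y}" using c N N2 by simp
  also have "{y \<in> ?A \<union> ?B. ?x \<le> y} \<subseteq> {y \<in> subtree_chips K v. ?x - 1 < y}"
    using subtree_chips_split[of v] assms(2) x1 by auto
  hence "card {y \<in> ?A \<union> ?B. ?x \<le> y} \<le> larger K v (?x - 1)"
    unfolding larger_def using finite_subtree_chips by (intro card_mono) auto
  finally have "2 \<le> larger K (v @ [True]) (?x - 1)" using larger_right_2[OF assms] by simp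
  moreover have "{y \<in> ?B. ?x - 1 < y} = {y \<in> ?B. ?x \<le> y}" using x1 by auto
  ultimately show "2 \<le> count_list (drop (length (snd (code K v)) - 2) (snd (code K v))) False"
    using count_take_code(4)[of v ?x] c unfolding N_def[symmetric] by (simp add: code_def larger_def)
qed simp

text \<open>Above the chip of a left child lie the chip of its right child and, as that one is not
  the largest of its subtree, at least one more chip of the right subtree.\<close>

lemma code_left_child:
  assumes "v = p @ [False]" "length v + 3 \<le> m"
  shows "2 \<le> count_list (drop (fst (code K v) - 1) (snd (code K v))) False"
proof -
  let ?B = "subtree_chips K (v @ [True])" and ?c = "chip K (v @ [True])"
  have less: "chip K v < ?c" using chip_less_right assms by simp
  have "1 \<le> card {y \<in> ?B. ?c < y}" using larger_chip_1[of "v @ [True]"] assms(2) by (simp add: larger_def)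
  hence "2 \<le> card (insert ?c {y \<in> ?B. ?c < y})" using finite_subtree_chips by simp
  also have "\<dots> \<le> card {y \<in> ?B. chip K v \<le> y}"
    using less chip_in_subtree[of "v @ [True]" "[]"] assms(2) finite_subtree_chips
    by (intro card_mono) auto
  finally show ?thesis
    using count_take_code(4)[of v "chip K v"] below_chip_children[of v] assms(2) by (simp add: code_def)
qed

lemma code_right_child:
  assumes "v = p @ [True]" "length v + 3 \<le> m"
  shows "2 \<le> count_list (take (fst (code K v) - 1) (snd (code K v))) True"
proof -
  let ?A = "subtree_chips K (v @ [False])" and ?c = "chip K (v @ [False])"
  have less: "?c < chip K v" using chip_left_less assms by simp
  have "1 \<le> card {y \<in> ?A. y < ?c}" using smaller_chip_1[of "v @ [False]"] assms(2) by (simp add: smaller_def)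
  hence "2 \<le> card (insert ?c {y \<in> ?A. y < ?c})" using finite_subtree_chips by simp
  also have "\<dots> \<le> card {y \<in> ?A. y < chip K v}"
    using less chip_in_subtree[of "v @ [False]" "[]"] assms(2) finite_subtree_chips
    by (intro card_mono) auto
  finally show ?thesis
    using count_take_code(1)[of v "chip K v"] below_chip_children[of v] assms(2) by (simp add: code_def)
qed

lemma rank_bounds:
  assumes "length v + 3 \<le> m"
  shows "3 \<le> fst (code K v)" "fst (code K v) \<le> 2 ^ (m - length v) - 3"
  using rank_eq[of v] smaller_chip_2[of v] larger_chip_2[of v] assms by auto

lemma rank_bounds_root:
  assumes "4 \<le> m"
  shows "4 \<le> fst (code K [])" "fst (code K []) \<le> 2 ^ m - 4"
  using rank_eq[of "[]"] smaller_root_3 larger_root_3 assms by auto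

lemma code_1:
  assumes "length v + 1 = m"
  shows "code K v = (1, [])"
proof -
  have "fst (code K v) = 1" using rank_eq[of v] assms by auto
  moreover have "snd (code K v) = []" using length_code[of v] assms by auto
  ultimately show ?thesis by (metis prod.collapse)
qed

lemma code_2:
  assumes "length v + 2 = m"
  shows "code K v = (2, [True, False])"
proof -
  have "fst (code K v) = 2"
    using rank_eq[of v] smaller_chip_1[of v] larger_chip_1[of v] assms by auto
  moreover have "snd (code K v) = [True, False]"
  proof -
    have w: "snd (code K v) \<in> ballot_words 0 1 1" using code_ballot[of v] assms by auto
    then obtain x y where xy: "snd (code K v) = [x, y]"
      using length_eq_count_bool[of "snd (code K v)"]
      by (auto simp: ballot_words_def length_Suc_conv numeral_2_eq_2)
    have "count_list (take 1 (snd (code K v))) False \<le> count_list (take 1 (snd (code K v))) True"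
      using w by (simp add: ballot_words_def)
    thus ?thesis using w xy by (cases x; cases y) (auto simp: ballot_words_def)
  qed
  ultimately show ?thesis by (metis prod.collapse)
qed

end

text \<open>Of the five ballot words of length six, the alternating one has neither prefix
  \<open>[True, True]\<close> nor suffix \<open>[False, False]\<close>. Two words have both and
  allow all three ranks. \<open>[True, True, False, False, True, False]\<close> can occur only at
  left children, where two letters \<open>False\<close> must follow the root chip, which excludes
  rank \<open>5\<close>. Its mirror image can occur only at right children, where rank
  \<open>3\<close> is excluded.\<close>

definition codes_3 :: "(nat \<times> bool list) set" where
  "codes_3 = {3, 4, 5} \<times> {[True, True, True, False, False, False], [True, True, False, True, False, False]}
     \<union> {3, 4} \<times> {[True, True, False, False, True, False]}
     \<union> {4, 5} \<times> {[True, False, True, True, False, False]}"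

lemma card_codes_3: "card codes_3 = 10" and finite_codes_3: "finite codes_3"
proof -
  let ?L = "[(3, [True, True, True, False, False, False]), (4, [True, True, True, False, False, False]),
      (5, [True, True, True, False, False, False]), (3, [True, True, False, True, False, False]),
      (4, [True, True, False, True, False, False]), (5, [True, True, False, True, False, False]),
      (3, [True, True, False, False, True, False]), (4, [True, True, False, False, True, False]),
      (4, [True, False, True, True, False, False]), (5, [True, False, True, True, False, False])] :: (nat \<times> bool list) list"
  have eq: "codes_3 = set ?L" unfolding codes_3_def by auto
  have "distinct ?L" by simp
  from distinct_card[OF this] show "card codes_3 = 10" unfolding eq by simp
  show "finite codes_3" unfolding eq by (rule finite_set)
qed

lemma codes_3I:
  assumes w: "w \<in> ballot_words 0 3 3" and r: "r \<in> {3, 4, 5}"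
    and "take 2 w = [True, True] \<and> 2 \<le> count_list (drop (r - 1) w) False
      \<or> drop 4 w = [False, False] \<and> 2 \<le> count_list (take (r - 1) w) True"
  shows "(r, w) \<in> codes_3"
proof -
  have "length w = 6" using w length_eq_count_bool[of w] by (simp add: ballot_words_def)
  then obtain a b c d e f where w': "w = [a, b, c, d, e, f]"
    by (auto simp: length_Suc_conv eval_nat_numeral)
  have pre: "count_list (take k w) False \<le> count_list (take k w) True" for k
    using w by (simp add: ballot_words_def)
  have cnt: "count_list w True = 3" using w by (simp add: ballot_words_def)
  \<comment> \<open>Prefixes of odd length suffice: a path starting at height zero can first become
    negative only after an odd number of steps.\<close>
  show ?thesis
    using assms(3) r cnt pre[of 1] pre[of 3] pre[of 5] unfolding w' codes_3_def
    by (cases a; cases b; cases c; cases d; cases e; cases f) auto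
qed

lemma (in ballot_config) code_3:
  assumes "v \<noteq> []" "length v + 3 = m"
  shows "code K v \<in> codes_3"
proof -
  have e: "m - length v = 3" "m - Suc (length v) = 2" using assms(2) by auto
  have w: "snd (code K v) \<in> ballot_words 0 3 3" using code_ballot[of v] assms e by simp
  have r: "fst (code K v) \<in> {3, 4, 5}" using rank_bounds[of v] assms(2) e by auto
  have len: "length (snd (code K v)) = 6" using length_code[of v] e by simp
  obtain p d where v: "v = p @ [d]" using assms(1) by (metis rev_exhaust)
  have "take 2 (snd (code K v)) = [True, True] \<and> 2 \<le> count_list (drop (fst (code K v) - 1) (snd (code K v))) False
      \<or> drop 4 (snd (code K v)) = [False, False] \<and> 2 \<le> count_list (take (fst (code K v) - 1) (snd (code K v))) True"
  proof (cases d)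
    case True
    thus ?thesis using code_suffix[of v p] code_right_child[of v p] v assms(2) len by simp
  next
    case False
    thus ?thesis using code_prefix[of v p] code_left_child[of v p] v assms(2) by simp
  qed
  from codes_3I[OF w r this] show ?thesis by simp
qed

section \<open>The bounds\<close>

lemma order_patterns_Suc_subset:
  assumes bh: ballot_hypothesis
    and X: "\<And>K v. ballot_config (length v + Suc l) K \<Longrightarrow> v \<noteq> [] \<Longrightarrow> code K v \<in> X"
  shows "order_patterns (Suc l) \<subseteq>
    (\<lambda>((r, ws), P, Q). glue r ws P Q) ` (X \<times> order_patterns l \<times> order_patterns l)"
proof
  fix F assume "F \<in> order_patterns (Suc l)"
  then obtain m K v where F: "F = order_pattern (Suc l) K v" and m: "m > Suc l"
    and K: "K \<in> stable_configs (2 ^ m - 1)" and v: "v \<noteq> []" "layer v = m - Suc l + 1"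
    unfolding order_patterns_def by blast
  have bc: "ballot_config m K" by unfold_locales (use bh K m in auto)
  then interpret ballot_config m K .
  have len: "length v + Suc l = m" using v(2) m by (simp add: layer_def)
  have sub: "order_pattern l K (v @ [d]) \<in> order_patterns l" for d
    unfolding order_patterns_def
    by (rule CollectI, rule exI[of _ m], rule exI[of _ K], rule exI[of _ "v @ [d]"])
      (use m K len in \<open>auto simp: layer_def\<close>)
  have "F = (\<lambda>((r, ws), P, Q). glue r ws P Q)
      (code K v, order_pattern l K (v @ [False]), order_pattern l K (v @ [True]))"
    unfolding F order_pattern_Suc[OF len] by (simp add: code_def)
  thus "F \<in> (\<lambda>((r, ws), P, Q). glue r ws P Q) ` (X \<times> order_patterns l \<times> order_patterns l)"
    using sub X[of v K] bc v(1) len by blast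
qed

lemma T_num_Suc_le:
  assumes "ballot_hypothesis"
    and "\<And>K v. ballot_config (length v + Suc l) K \<Longrightarrow> v \<noteq> [] \<Longrightarrow> code K v \<in> X"
    and fin: "finite X" "finite (order_patterns l)"
  shows "finite (order_patterns (Suc l))" "T_num (Suc l) \<le> card X * (T_num l)\<^sup>2"
proof -
  note sub = order_patterns_Suc_subset[OF assms(1,2)]
  have f: "finite (X \<times> order_patterns l \<times> order_patterns l)" using fin by simp
  show "finite (order_patterns (Suc l))" using finite_subset[OF sub] f by simp
  have "T_num (Suc l) \<le> card (X \<times> order_patterns l \<times> order_patterns l)"
    unfolding T_num_def using surj_card_le[OF f sub] .
  thus "T_num (Suc l) \<le> card X * (T_num l)\<^sup>2"
    by (simp add: card_cartesian_product T_num_def power2_eq_square)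
qed

text \<open>In sizes one and two the code is forced, so the recursion leaves at most one pattern; in
  size three only the choice of the code remains.\<close>

lemma T_num_3:
  assumes bh: ballot_hypothesis
  shows "finite (order_patterns 2)" "T_num 2 \<le> 1" "finite (order_patterns 3)" "T_num 3 \<le> 10"
proof -
  have "order_patterns 0 \<subseteq> {\<lambda>w. {}}"
    by (auto simp: order_patterns_def order_pattern_def Let_def)
  hence f0: "finite (order_patterns 0)" and T0: "T_num 0 \<le> 1"
    using finite_subset[of "order_patterns 0"] card_mono[of "{\<lambda>w. {}}" "order_patterns 0"]
    by (auto simp: T_num_def)
  have sq: "n \<le> 1 \<Longrightarrow> n\<^sup>2 \<le> 1" for n :: nat by (auto simp: le_Suc_eq)
  have "code K v \<in> {(1, [])}" if "ballot_config (length v + Suc 0) K" for K v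
    using ballot_config.code_1[OF that] by simp
  from T_num_Suc_le[OF bh this _ f0]
  have f1: "finite (order_patterns 1)" and "T_num 1 \<le> (T_num 0)\<^sup>2" by simp_all
  hence T1: "T_num 1 \<le> 1" using sq[OF T0] by simp
  have "code K v \<in> {(2, [True, False])}" if "ballot_config (length v + Suc 1) K" for K v
    using ballot_config.code_2[OF that] by simp
  from T_num_Suc_le[OF bh this _ f1]
  show f2: "finite (order_patterns 2)" and T2: "T_num 2 \<le> 1"
    using sq[OF T1] by (auto simp: numeral_2_eq_2)
  have "code K v \<in> codes_3" if "ballot_config (length v + Suc 2) K" "v \<noteq> []" for K v
    using ballot_config.code_3[OF that] by simp
  from T_num_Suc_le[OF bh this finite_codes_3 f2]
  show "finite (order_patterns 3)" "T_num 3 \<le> 10"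
    using sq[OF T2] by (auto simp: card_codes_3 numeral_3_eq_3 numeral_2_eq_2)
qed

text \<open>The recursion \<open>T_bound_Suc\<close> unrolled down to the value \<open>10\<close> at
  size three; every level doubles the number of subtrees, hence the exponents
  \<open>2 ^ i\<close>.\<close>

definition T_bound :: "nat \<Rightarrow> real" where
  "T_bound l = 10 ^ (2 ^ (l - 3)) *
     (\<Prod>i<l - 3. ((2 ^ (l - i) - 4) * catalan (2 ^ (l - i - 1) - 1)) ^ (2 ^ i))"

text \<open>The last two factors of the bound on stable configurations are the contribution of the
  two subtrees below the root.\<close>

lemma T_bound_sq:
  assumes "3 \<le> l"
  shows "(T_bound l)\<^sup>2 = 10 ^ (2 ^ (Suc l - 3)) *
     (\<Prod>i<Suc l - 4. ((2 ^ (Suc l - 1 - i) - 4) * catalan (2 ^ (Suc l - i - 2) - 1)) ^ (2 ^ (i + 1)))"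
proof -
  have "Suc l - 3 = Suc (l - 3)" using assms by simp
  hence "((10::real) ^ (2 ^ (l - 3)))\<^sup>2 = 10 ^ (2 ^ (Suc l - 3))"
    by (simp only: power_Suc power_mult[symmetric] mult.commute)
  moreover have "(x ^ (2 ^ i))\<^sup>2 = x ^ (2 ^ (i + 1))" for x :: real and i
    by (simp add: power_mult[symmetric] mult.commute)
  ultimately show ?thesis
    unfolding T_bound_def power_mult_distrib prod_power_distrib by simp
qed

lemma T_bound_Suc:
  assumes "3 \<le> l"
  shows "T_bound (Suc l) = (2 ^ Suc l - 4) * catalan (2 ^ l - 1) * (T_bound l)\<^sup>2"
proof -
  have "Suc l - 3 = Suc (l - 3)" using assms by simp
  thus ?thesis unfolding T_bound_sq[OF assms] unfolding T_bound_def
    by (simp add: prod.lessThan_Suc_shift del: prod.lessThan_Suc)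
qed

lemma card_ballot_words_catalan: "real (card (ballot_words 0 n n)) \<le> catalan n"
  using card_ballot_words[of n 0 n] by (simp add: catalan_eq mult_2)

lemma T_num_le:
  assumes bh: ballot_hypothesis and "3 \<le> l"
  shows "finite (order_patterns l) \<and> real (T_num l) \<le> T_bound l"
  using assms(2)
proof (induction l rule: dec_induct)
  case base
  show ?case using T_num_3[OF bh] by (simp add: T_bound_def)
next
  case (step l)
  let ?n = "2 ^ l - 1 :: nat"
  let ?X = "{3..2 ^ Suc l - 3 :: nat} \<times> ballot_words 0 ?n ?n"
  have "code K v \<in> ?X" if bc: "ballot_config (length v + Suc l) K" for K v
  proof -
    have "fst (code K v) \<in> {3..2 ^ Suc l - 3}" "snd (code K v) \<in> ballot_words 0 ?n ?n"
      using ballot_config.rank_bounds[OF bc, of v] ballot_config.code_ballot[OF bc, of v] step.hyps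
      by auto
    thus ?thesis by (metis mem_Times_iff)
  qed
  from T_num_Suc_le[OF bh this] step.IH
  have f: "finite (order_patterns (Suc l))" and le: "T_num (Suc l) \<le> card ?X * (T_num l)\<^sup>2"
    by (simp_all add: finite_ballot_words)
  have p: "(2::nat) ^ 4 \<le> 2 ^ Suc l" using step.hyps by (intro power_increasing) auto
  \<comment> \<open>There are \<open>2 ^ Suc l - 5\<close> ranks; the stated bound has the slightly
    larger factor \<open>2 ^ Suc l - 4\<close>.\<close>
  have "real (card {3..2 ^ Suc l - 3 :: nat}) = 2 ^ Suc l - 5"
    using p by (simp add: of_nat_diff)
  moreover have "(4::real) \<le> 2 ^ Suc l" using power_increasing[of 2 "Suc l" "2::real"] step.hyps by simp
  ultimately have X: "real (card ?X) \<le> (2 ^ Suc l - 4) * catalan ?n"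
    unfolding card_cartesian_product of_nat_mult
    by (intro mult_mono card_ballot_words_catalan) auto
  have "real (T_num (Suc l)) \<le> real (card ?X) * (real (T_num l))\<^sup>2"
    using le by (metis of_nat_le_iff of_nat_mult of_nat_power)
  also have "\<dots> \<le> ((2 ^ Suc l - 4) * catalan ?n) * (T_bound l)\<^sup>2"
    using X step.IH by (intro mult_mono power_mono) auto
  finally show ?case using f T_bound_Suc[OF step.hyps(1)] by simp
qed

section \<open>Counting stable configurations\<close>

lemma Z_num_Suc_le:
  assumes bh: ballot_hypothesis
    and X: "\<And>K. ballot_config (Suc l) K \<Longrightarrow> code K [] \<in> X"
    and fin: "finite X" "finite (order_patterns l)"
  shows "Z_num (Suc l) \<le> card X * (T_num l)\<^sup>2"
proof -
  have f: "finite (X \<times> order_patterns l \<times> order_patterns l)" using fin by simp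
  have "stable_configs (2 ^ Suc l - 1) \<subseteq>
    (\<lambda>((r, ws), P, Q). glue r ws P Q) ` (X \<times> order_patterns l \<times> order_patterns l)"
  proof
    fix K assume K: "K \<in> stable_configs (2 ^ Suc l - 1)"
    have bc: "ballot_config (Suc l) K" by unfold_locales (use bh K in auto)
    then interpret ballot_config "Suc l" K .
    have S: "subtree_chips K [] = {1..2 ^ Suc l - 1}"
      using config_on by (simp add: subtree_chips_def config_on_def)
    \<comment> \<open>The chips below the root are all labels from \<open>1\<close> on, so rank and
      label coincide and the pattern is the configuration itself.\<close>
    have "order_pattern (Suc l) K [] w = K w" for w
    proof (cases "length w < Suc l")
      case True
      hence "chip K w \<in> {1..2 ^ Suc l - 1}" using chip_in_subtree[of "[]" w] S by simp
      hence "{y \<in> {1..2 ^ Suc l - 1}. y \<le> chip K w} = {1..chip K w}" by auto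
      thus ?thesis using order_pattern_eq[of "[]" "Suc l"] config_eq[of w] S True by (simp add: rank_in_def)
    next
      case False
      thus ?thesis using order_pattern_eq[of "[]" "Suc l"] config_eq[of w] by simp
    qed
    hence "K = order_pattern (Suc l) K []" by (simp add: fun_eq_iff)
    also have "\<dots> = (\<lambda>((r, ws), P, Q). glue r ws P Q)
        (code K [], order_pattern l K [False], order_pattern l K [True])"
      using order_pattern_Suc[of "[]" l] by (simp add: code_def)
    finally have "K = (\<lambda>((r, ws), P, Q). glue r ws P Q)
        (code K [], order_pattern l K [False], order_pattern l K [True])" .
    moreover have "order_pattern l K [d] \<in> order_patterns l" for d
      unfolding order_patterns_def
      by (rule CollectI, rule exI[of _ "Suc l"], rule exI[of _ K], rule exI[of _ "[d]"])
        (use K in \<open>auto simp: layer_def\<close>)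
    ultimately show "K \<in> (\<lambda>((r, ws), P, Q). glue r ws P Q) ` (X \<times> order_patterns l \<times> order_patterns l)"
      using X[OF bc] by blast
  qed
  from surj_card_le[OF f this] show ?thesis
    by (simp add: Z_num_def T_num_def card_cartesian_product power2_eq_square)
qed

text \<open>The sharper rank range at the root needs four layers, so three layers are counted
  directly: three ranks, five ballot words and at most one pattern per child give
  \<open>15\<close>.\<close>

lemma Z_num_3: "ballot_hypothesis \<Longrightarrow> Z_num 3 \<le> 20"
proof -
  assume bh: ballot_hypothesis
  have "code K [] \<in> {3..5} \<times> ballot_words 0 3 3" if bc: "ballot_config (Suc 2) K" for K
  proof -
    have "fst (code K []) \<in> {3..5}" "snd (code K []) \<in> ballot_words 0 3 3"
      using ballot_config.rank_bounds[OF bc, of "[]"] ballot_config.code_ballot[OF bc, of "[]"] by auto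
    thus ?thesis by (metis mem_Times_iff)
  qed
  from Z_num_Suc_le[OF bh this _ T_num_3(1)[OF bh]]
  have le: "Z_num 3 \<le> 3 * card (ballot_words 0 3 3) * (T_num 2)\<^sup>2"
    by (simp add: finite_ballot_words card_cartesian_product numeral_3_eq_3[symmetric])
  have "(T_num 2)\<^sup>2 \<le> 1" using T_num_3(2)[OF bh] by (auto simp: le_Suc_eq)
  moreover have "card (ballot_words 0 3 3) \<le> 5"
    using card_ballot_words_catalan[of 3] by (simp add: catalan_def binomial_fact fact_numeral)
  ultimately have "3 * card (ballot_words 0 3 3) * (T_num 2)\<^sup>2 \<le> 3 * 5 * 1"
    by (intro mult_le_mono) auto
  from le_trans[OF le this] show ?thesis by simp
qed

text \<open>After the two forced up steps the path is at height two, so the middle part is a ballot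
  word with starting height \<open>2\<close>.\<close>

lemma ballot_word_between:
  assumes w: "w \<in> ballot_words 0 n n" and n: "3 \<le> n"
    and pre: "take 2 w = [True, True]" and suf: "drop (length w - 2) w = [False, False]"
  shows "w \<in> (\<lambda>u. [True, True] @ u @ [False, False]) ` ballot_words 2 (n - 2) (n - 2)"
proof -
  define u where "u = drop 2 (take (length w - 2) w)"
  have len: "length w = 2 * n" using w length_eq_count_bool[of w] by (simp add: ballot_words_def)
  have "take 2 (take (length w - 2) w) = take 2 w" using len n by (simp add: min_absorb1)
  hence "w = take 2 w @ u @ drop (length w - 2) w"
    unfolding u_def by (metis append_assoc append_take_drop_id)
  hence wu: "w = [True, True] @ u @ [False, False]" using pre suf by simp
  have "count_list (take k u) False \<le> 2 + count_list (take k u) True" for k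
  proof -
    have "count_list (take (2 + min k (length u)) w) False \<le> count_list (take (2 + min k (length u)) w) True"
      using w by (simp add: ballot_words_def)
    moreover have "take (2 + min k (length u)) w = True # True # take k u"
      unfolding wu by (simp add: min_def)
    ultimately show ?thesis by simp
  qed
  moreover have "count_list u True = n - 2" "count_list u False = n - 2"
    using w unfolding ballot_words_def wu by auto
  ultimately have "u \<in> ballot_words 2 (n - 2) (n - 2)" by (simp add: ballot_words_def)
  thus ?thesis using wu by blast
qed

lemma Z_num_le:
  assumes bh: ballot_hypothesis and l: "3 \<le> l"
  shows "real (Z_num (Suc l)) \<le> (2 ^ Suc l - 7) *
    (binom (2 ^ Suc l - 6) (2 ^ l - 3) - binom (2 ^ Suc l - 6) (2 ^ l - 6)) * (T_bound l)\<^sup>2"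
proof -
  let ?n = "2 ^ l - 1 :: nat"
  let ?W = "ballot_words 2 (?n - 2) (?n - 2)"
  let ?X = "{4..2 ^ Suc l - 4 :: nat} \<times> (\<lambda>u. [True, True] @ u @ [False, False]) ` ?W"
  have p: "(2::nat) ^ 3 \<le> 2 ^ l" using l by (intro power_increasing) auto
  have "code K [] \<in> ?X" if bc: "ballot_config (Suc l) K" for K
  proof -
    have "fst (code K []) \<in> {4..2 ^ Suc l - 4}"
      using ballot_config.rank_bounds_root[OF bc] l by auto
    moreover have "snd (code K []) \<in> (\<lambda>u. [True, True] @ u @ [False, False]) ` ?W"
    proof (rule ballot_word_between)
      show "snd (code K []) \<in> ballot_words 0 ?n ?n"
        using ballot_config.code_ballot[OF bc, of "[]"] l by simp
      show "take 2 (snd (code K [])) = [True, True]"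
        using ballot_config.code_prefix[OF bc, of "[]"] l by simp
      show "drop (length (snd (code K [])) - 2) (snd (code K [])) = [False, False]"
        using ballot_config.code_suffix[OF bc, of "[]"] l by simp
    qed (use p in simp)
    ultimately show ?thesis by (metis mem_Times_iff)
  qed
  from Z_num_Suc_le[OF bh this] T_num_le[OF bh l]
  have le: "Z_num (Suc l) \<le> card ?X * (T_num l)\<^sup>2" by (simp add: finite_ballot_words)
  \<comment> \<open>With \<open>n = 2 ^ l - 1\<close>, the middle part has \<open>n - 2\<close>
    letters of each kind, and reflection from height two lowers the index by three.\<close>
  have n: "int (?n - 2) = 2 ^ l - 3" "?n - 2 + (?n - 2) = 2 ^ Suc l - 6" "int (?n - 2) - int 2 - 1 = 2 ^ l - 6"
    using p by (auto simp: of_nat_diff)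
  have "real (card ?W) \<le> binom (2 ^ Suc l - 6) (2 ^ l - 3) - binom (2 ^ Suc l - 6) (2 ^ l - 6)"
    using card_ballot_words[of "?n - 2" 2 "?n - 2"] unfolding n by simp
  moreover have "card ((\<lambda>u. [True, True] @ u @ [False, False]) ` ?W) \<le> card ?W"
    by (rule card_image_le) (rule finite_ballot_words)
  moreover have "real (card {4..2 ^ Suc l - 4 :: nat}) = 2 ^ Suc l - 7"
    using p by (simp add: of_nat_diff)
  ultimately have X: "real (card ?X) \<le> (2 ^ Suc l - 7) *
      (binom (2 ^ Suc l - 6) (2 ^ l - 3) - binom (2 ^ Suc l - 6) (2 ^ l - 6))"
    unfolding card_cartesian_product of_nat_mult by (intro mult_mono) auto
  have "real (Z_num (Suc l)) \<le> real (card ?X) * (real (T_num l))\<^sup>2"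
    using le by (metis of_nat_le_iff of_nat_mult of_nat_power)
  also have "\<dots> \<le> ((2 ^ Suc l - 7) *
      (binom (2 ^ Suc l - 6) (2 ^ l - 3) - binom (2 ^ Suc l - 6) (2 ^ l - 6))) * (T_bound l)\<^sup>2"
    using X T_num_le[OF bh l] by (intro mult_mono power_mono) (auto intro: order_trans[OF _ X])
  finally show ?thesis .
qed

theorem mainTheorem10:
  assumes "ballot_hypothesis"
  shows "\<forall>l::nat. l \<ge> 3 \<longrightarrow>
      real (T_num l) \<le>
        10 ^ (2 ^ (l - 3)) *
        (\<Prod>i<l - 3. ((2 ^ (l - i) - 4) * catalan (2 ^ (l - i - 1) - 1)) ^ (2 ^ i))
    \<and> real (Z_num l) \<le>
        (2 ^ l - 7) *
        (binom (2 ^ l - 6) (2 ^ (l - 1) - 3) - binom (2 ^ l - 6) (2 ^ (l - 1) - 6)) *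
        10 ^ (2 ^ (l - 3)) *
        (\<Prod>i<l - 4. ((2 ^ (l - 1 - i) - 4) * catalan (2 ^ (l - i - 2) - 1)) ^ (2 ^ (i + 1)))"
proof (intro allI impI conjI)
  fix l :: nat assume l: "3 \<le> l"
  show "real (T_num l) \<le> 10 ^ (2 ^ (l - 3)) *
        (\<Prod>i<l - 3. ((2 ^ (l - i) - 4) * catalan (2 ^ (l - i - 1) - 1)) ^ (2 ^ i))"
    using T_num_le[OF assms l] by (simp add: T_bound_def)
  show "real (Z_num l) \<le>
        (2 ^ l - 7) *
        (binom (2 ^ l - 6) (2 ^ (l - 1) - 3) - binom (2 ^ l - 6) (2 ^ (l - 1) - 6)) *
        10 ^ (2 ^ (l - 3)) *
        (\<Prod>i<l - 4. ((2 ^ (l - 1 - i) - 4) * catalan (2 ^ (l - i - 2) - 1)) ^ (2 ^ (i + 1)))"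
  proof (cases "l = 3")
    case True
    \<comment> \<open>Here the stated bound is \<open>1 * (2 - 0) * 10 = 20\<close>: the second
      coefficient has lower index \<open>-2\<close> and vanishes, and the product is empty.\<close>
    thus ?thesis using Z_num_3[OF assms] by (simp add: binom_def)
  next
    case False
    then obtain k where k: "l = Suc k" "3 \<le> k" using l by (cases l) auto
    show ?thesis using Z_num_le[OF assms k(2)] unfolding T_bound_sq[OF k(2)] k(1)
      by (simp only: diff_Suc_1 mult.assoc)
  qed
qed

end
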